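(* Let $\mathcal{N}$ be a von Neumann algebra that is not isomorphic to $\mathbb{C}^2$ and has no type $I_2$ summand. Let $\rho_0\in\mathcal{S}(\mathcal{N})$ be a state of $\mathcal{N}$, and let $m_{\rho_0}$ be the corresponding global section of $\underline{CP}$. Let $\underline{S}_0\in\mathrm{Sub}_{\mathrm{cl}}\underline{\Sigma}^{\mathcal{N}}$ be a clopen subobject of the spectral presheaf. Let $(\hat U_t)_{t\in\mathbb{R}}$ be a strongly continuous one-parameter group of unitaries in $\mathcal{N}$, let $m_{\rho_t}$ be the global section of $\underline{CP}$ corresponding to the state $\rho_t=\hat U_t.\rho_0=\rho_0\circ\phi_{\hat U_{-t}}$, and let $\underline{S}_t$ be the clopen subobject $\underline{S}_t:=\underline{\tilde\phi}_{\hat U_t}(\underline{S}_0)$. Then, for all $V\in\mathcal{V}(\mathcal{N})$ and all $t\in\mathbb{R}$, $$(m_{\rho_t}(\underline{S}_0))_V=(m_{\rho_0}(\underline{S}_t))_{\hat U_{-t}V\hat U_t}.$$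
   Context: $\mathcal{V}(\mathcal{N})$ is the context category of $\mathcal{N}$: the poset, under inclusion, of non-trivial abelian von Neumann subalgebras of $\mathcal{N}$ sharing the unit element with $\mathcal{N}$. The spectral presheaf $\underline{\Sigma}^{\mathcal{N}}$ over $\mathcal{V}(\mathcal{N})$ has components $\underline{\Sigma}^{\mathcal{N}}_V$ = Gelfand spectrum of $V$, with restriction maps $\lambda\mapsto\lambda|_{V'}$ for $V'\subseteq V$. A clopen subobject $\underline{S}$ is a family $(\underline{S}_V)_{V\in\mathcal{V}(\mathcal{N})}$ of clopen subsets $\underline{S}_V\subseteq\underline{\Sigma}^{\mathcal{N}}_V$ with $\{\lambda|_{V'}:\lambda\in\underline{S}_V\}\subseteq\underline{S}_{V'}$ for all $V'\subseteq V$; the set of these is $\mathrm{Sub}_{\mathrm{cl}}\underline{\Sigma}^{\mathcal{N}}$. Clopen subobjects represent propositions about the quantum system. $\mathcal{P}(V)$ is the projection lattice of $V$, $\mathcal{C}l(\underline{\Sigma}^{\mathcal{N}}_V)$ the Boolean algebra of clopen subsets of $\underline{\Sigma}^{\mathcal{N}}_V$, and $\alpha_V:\mathcal{P}(V)\to\mathcal{C}l(\underline{\Sigma}^{\mathcal{N}}_V)$, $\hat P\mapsto\{\lambda:\lambda(\hat P)=1\}$ is the standard isomorphism. $\underline{CP}$ is the presheaf over $\mathcal{V}(\mathcal{N})$ with $\underline{CP}_V$ the set of finitely additive probability measures $\mathcal{C}l(\underline{\Sigma}^{\mathcal{N}}_V)\to[0,1]$ and, for $V'\subseteq V$, $\underline{CP}_V\to\underline{CP}_{V'}$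 given by pushforward along the restriction map $\underline{\Sigma}^{\mathcal{N}}_V\to\underline{\Sigma}^{\mathcal{N}}_{V'}$. The global section $m_\rho=(m_{\rho;V})_{V\in\mathcal{V}(\mathcal{N})}$ corresponding to a state $\rho$ has components $m_{\rho;V}=\rho|_V\circ\alpha_V^{-1}$. The state-proposition pairing assigns to $m_\rho$ and $\underline{S}$ the antitone function $m_\rho(\underline{S}):\mathcal{V}(\mathcal{N})\to[0,1]$, $(m_\rho(\underline{S}))_V:=m_{\rho;V}(\underline{S}_V)$. For a unitary $\hat U\in\mathcal{N}$, $\phi_{\hat U}:\mathcal{N}\to\mathcal{N}$ is $\hat A\mapsto\hat U\hat A\hat U^*$, and $\underline{\tilde\phi}_{\hat U}:\mathrm{Sub}_{\mathrm{cl}}\underline{\Sigma}^{\mathcal{N}}\to\mathrm{Sub}_{\mathrm{cl}}\underline{\Sigma}^{\mathcal{N}}$ is given by $(\underline{\tilde\phi}_{\hat U}(\underline{S}))_V=\{\lambda\circ\phi_{\hat U}|_V:\lambda\in\underline{S}_{\hat UV\hat U^*}\}$. A strongly continuous one-parameter group satisfies $\hat U_t^*=\hat U_{-t}$. States need not be normal. *)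

theory Defs
  imports "HOL-Analysis.Analysis" "HOL-Library.FuncSet" "HOL-Library.Nonpos_Ints"
begin

section \<open>Complex Hilbert spaces and their bounded operators\<close>

text \<open>A complex Hilbert space is a (real) Banach space with a compatible complex scalar
  multiplication whose norm comes from an inner product. The inner product is linear in the
  second argument; conjugate linearity in the first one follows from conjugate symmetry.\<close>

class complex_hilbert = banach +
  fixes scaleC :: "complex \<Rightarrow> 'a \<Rightarrow> 'a" (infixr \<open>*\<^sub>C\<close> 75)
    and cinner :: "'a \<Rightarrow> 'a \<Rightarrow> complex"
  assumes scaleC_add_right: "c *\<^sub>C (x + y) = c *\<^sub>C x + c *\<^sub>C y"
    and scaleC_add_left: "(c + d) *\<^sub>C x = c *\<^sub>C x + d *\<^sub>C x"
    and scaleC_scaleC: "c *\<^sub>C d *\<^sub>C x = (c * d) *\<^sub>C x"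
    and scaleC_of_real: "complex_of_real r *\<^sub>C x = r *\<^sub>R x"
    and cinner_commute: "cinner x y = cnj (cinner y x)"
    and cinner_add_right: "cinner x (y + z) = cinner x y + cinner x z"
    and cinner_scaleC_right: "cinner x (c *\<^sub>C y) = c * cinner x y"
    and cinner_self: "cinner x x = complex_of_real ((norm x)\<^sup>2)"

lemma cinner_scaleC_left: "cinner (c *\<^sub>C x) y = cnj c * cinner x y"
  for x y :: "'a::complex_hilbert"
  by (metis cinner_commute cinner_scaleC_right complex_cnj_mult)

lemma norm_scaleC: "norm (c *\<^sub>C x) = cmod c * norm x" for x :: "'a::complex_hilbert"
proof -
  have "complex_of_real ((norm (c *\<^sub>C x))\<^sup>2) = c * cnj c * complex_of_real ((norm x)\<^sup>2)"
    by (simp only: cinner_self [symmetric] cinner_scaleC_left cinner_scaleC_right mult.assoc)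
  also have "\<dots> = complex_of_real ((cmod c * norm x)\<^sup>2)"
    by (simp add: complex_norm_square [symmetric] power_mult_distrib)
  finally have "(norm (c *\<^sub>C x))\<^sup>2 = (cmod c * norm x)\<^sup>2"
    using of_real_eq_iff by blast
  then show ?thesis
    by (simp add: power2_eq_iff_nonneg)
qed

text \<open>\<open>'a op\<close> contains all bounded real-linear maps; \<open>bounded_ops\<close> is $B(H)$.\<close>

type_synonym 'a op = "'a \<Rightarrow>\<^sub>L 'a"

definition bounded_ops :: "'a::complex_hilbert op set" where
  "bounded_ops = {A :: 'a op. \<forall>c x. A (c *\<^sub>C x) = c *\<^sub>C A x}"

lift_definition scale_op :: "complex \<Rightarrow> 'a::complex_hilbert op \<Rightarrow> 'a op"
  is "\<lambda>c A x. c *\<^sub>C A x"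
proof -
  fix c :: complex and A :: "'a \<Rightarrow> 'a"
  assume "bounded_linear A"
  moreover have "bounded_linear (\<lambda>x::'a. c *\<^sub>C x)"
    by (rule bounded_linear_intro [where K = "cmod c"])
      (simp_all add: scaleC_add_right norm_scaleC mult.commute
        scaleC_of_real [symmetric] scaleC_scaleC)
  ultimately show "bounded_linear (\<lambda>x. c *\<^sub>C A x)"
    using bounded_linear_compose by blast
qed

definition adj :: "'a::complex_hilbert op \<Rightarrow> 'a op" where
  "adj A = (THE B :: 'a op. \<forall>x y. cinner (B x) y = cinner x (A y))"

definition unitary :: "'a::complex_hilbert op \<Rightarrow> bool" where
  "unitary U \<longleftrightarrow> U \<in> bounded_ops \<and> adj U o\<^sub>L U = id_blinfun \<and> U o\<^sub>L adj U = id_blinfun"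

definition projections :: "'a::complex_hilbert op set \<Rightarrow> 'a op set" where
  "projections M = {P \<in> M. P o\<^sub>L P = P \<and> adj P = P}"

definition commuting :: "'a::complex_hilbert op set \<Rightarrow> bool" where
  "commuting M \<longleftrightarrow> (\<forall>A\<in>M. \<forall>B\<in>M. A o\<^sub>L B = B o\<^sub>L A)"


section \<open>Von Neumann algebras\<close>

definition commutant :: "'a::complex_hilbert op set \<Rightarrow> 'a op set" where
  "commutant M = {A \<in> bounded_ops. \<forall>B\<in>M. A o\<^sub>L B = B o\<^sub>L A}"

text \<open>Being a commutant, such an \<open>N\<close> is a unital subalgebra of $B(H)$.\<close>

definition von_neumann_algebra :: "'a::complex_hilbert op set \<Rightarrow> bool" where
  "von_neumann_algebra N \<longleftrightarrow>
     N \<subseteq> bounded_ops \<and> (\<forall>A\<in>N. adj A \<in> N) \<and> commutant (commutant N) = N"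

text \<open>The operations of \<open>complex ^ 2\<close>, including multiplication, are componentwise.\<close>

definition isomorphic_C2 :: "'a::complex_hilbert op set \<Rightarrow> bool" where
  "isomorphic_C2 N \<longleftrightarrow> (\<exists>f :: 'a op \<Rightarrow> complex ^ 2. bij_betw f N UNIV \<and>
     (\<forall>A\<in>N. \<forall>B\<in>N. f (A + B) = f A + f B \<and> f (A o\<^sub>L B) = f A * f B) \<and>
     (\<forall>A\<in>N. \<forall>c. f (scale_op c A) = c *s f A) \<and>
     (\<forall>A\<in>N. f (adj A) = (\<chi> i. cnj (f A $ i))))"

text \<open>Murray--von Neumann equivalence of projections relative to \<open>M\<close>.\<close>

definition equiv_projections :: "'a::complex_hilbert op set \<Rightarrow> 'a op \<Rightarrow> 'a op \<Rightarrow> bool" where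
  "equiv_projections M E F \<longleftrightarrow> (\<exists>W\<in>M. adj W o\<^sub>L W = E \<and> W o\<^sub>L adj W = F)"

definition abelian_projection :: "'a::complex_hilbert op set \<Rightarrow> 'a op \<Rightarrow> bool" where
  "abelian_projection M E \<longleftrightarrow> E \<in> projections M \<and> commuting ((\<lambda>A. E o\<^sub>L A o\<^sub>L E) ` M)"

text \<open>The algebra \<open>M\<close>, with unit element \<open>e\<close>, is of type $I_n$: its unit is the sum of \<open>n\<close>
  orthogonal equivalent abelian projections. The unit is a parameter since a direct summand
  of a von Neumann algebra does not contain the identity operator of the ambient space.\<close>

definition type_I :: "nat \<Rightarrow> 'a::complex_hilbert op set \<Rightarrow> 'a op \<Rightarrow> bool" where
  "type_I n M e \<longleftrightarrow> (\<exists>E :: nat \<Rightarrow> 'a op.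
     (\<forall>i<n. abelian_projection M (E i)) \<and>
     (\<forall>i<n. \<forall>j<n. i \<noteq> j \<longrightarrow> E i o\<^sub>L E j = 0) \<and>
     (\<forall>i<n. \<forall>j<n. equiv_projections M (E i) (E j)) \<and>
     (\<Sum>i<n. E i) = e)"

text \<open>The direct summands of \<open>N\<close> are the algebras $ZN$ for central projections $Z$.\<close>

definition has_type_I_summand :: "nat \<Rightarrow> 'a::complex_hilbert op set \<Rightarrow> bool" where
  "has_type_I_summand n N \<longleftrightarrow>
     (\<exists>Z \<in> projections N \<inter> commutant N. Z \<noteq> 0 \<and> type_I n ((\<lambda>A. Z o\<^sub>L A) ` N) Z)"

text \<open>Positivity reads $\rho(A^* A) \geq 0$. Only the values on \<open>N\<close> matter.\<close>

definition state_on :: "'a::complex_hilbert op set \<Rightarrow> ('a op \<Rightarrow> complex) \<Rightarrow> bool" where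
  "state_on N \<rho> \<longleftrightarrow>
     (\<forall>A\<in>N. \<forall>B\<in>N. \<rho> (A + B) = \<rho> A + \<rho> B) \<and>
     (\<forall>A\<in>N. \<forall>c. \<rho> (scale_op c A) = c * \<rho> A) \<and>
     (\<forall>A\<in>N. \<rho> (adj A o\<^sub>L A) \<in> \<real>\<^sub>\<ge>\<^sub>0) \<and>
     \<rho> id_blinfun = 1"

definition unitary_group_in ::
    "'a::complex_hilbert op set \<Rightarrow> (real \<Rightarrow> 'a op) \<Rightarrow> bool" where
  "unitary_group_in N U \<longleftrightarrow>
     (\<forall>t. U t \<in> N \<and> unitary (U t)) \<and>
     U 0 = id_blinfun \<and> (\<forall>s t. U (s + t) = U s o\<^sub>L U t) \<and>
     (\<forall>x. continuous_on UNIV (\<lambda>t. U t x))"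


section \<open>The spectral presheaf\<close>

text \<open>Every subalgebra \<open>V\<close> below contains the identity operator, hence shares its unit with \<open>N\<close>;
  the trivial algebra consists of the multiples of the identity.\<close>

definition contexts :: "'a::complex_hilbert op set \<Rightarrow> 'a op set set" where
  "contexts N = {V. V \<subseteq> N \<and> von_neumann_algebra V \<and> commuting V \<and>
                    V \<noteq> range (\<lambda>c. scale_op c id_blinfun)}"

text \<open>Gelfand spectrum: characters of \<open>V\<close> (being functions on \<open>V\<close>, they are \<open>undefined\<close> outside
  \<open>V\<close>), with the topology of pointwise convergence.\<close>

definition spectrum :: "'a::complex_hilbert op set \<Rightarrow> ('a op \<Rightarrow> complex) set" where
  "spectrum V = {l \<in> extensional V.
     (\<forall>A\<in>V. \<forall>B\<in>V. l (A + B) = l A + l B \<and> l (A o\<^sub>L B) = l A * l B) \<and>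
     (\<forall>A\<in>V. \<forall>c. l (scale_op c A) = c * l A) \<and>
     l id_blinfun = 1}"

definition spectrum_topology ::
    "'a::complex_hilbert op set \<Rightarrow> ('a op \<Rightarrow> complex) topology" where
  "spectrum_topology V = subtopology (product_topology (\<lambda>_. euclidean) V) (spectrum V)"

definition clopens :: "'a::complex_hilbert op set \<Rightarrow> ('a op \<Rightarrow> complex) set set" where
  "clopens V = {S. openin (spectrum_topology V) S \<and> closedin (spectrum_topology V) S}"

type_synonym 'a subobject = "'a op set \<Rightarrow> ('a op \<Rightarrow> complex) set"

definition clopen_subobjects :: "'a::complex_hilbert op set \<Rightarrow> 'a subobject set" where
  "clopen_subobjects N = {S.
     (\<forall>V \<in> contexts N. S V \<in> clopens V) \<and>
     (\<forall>V \<in> contexts N. \<forall>V' \<in> contexts N. V' \<subseteq> V \<longrightarrow> (\<lambda>l. restrict l V') ` S V \<subseteq> S V')}"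

definition alpha :: "'a::complex_hilbert op set \<Rightarrow> 'a op \<Rightarrow> ('a op \<Rightarrow> complex) set" where
  "alpha V P = {l \<in> spectrum V. l P = 1}"


section \<open>States, propositions and unitaries\<close>

text \<open>$m_{\rho;V} = \rho|_V \circ \alpha_V^{-1}$; the real part only converts the type, since
  states take real values on projections.\<close>

definition measure_section ::
    "('a::complex_hilbert op \<Rightarrow> complex) \<Rightarrow> 'a op set \<Rightarrow> ('a op \<Rightarrow> complex) set \<Rightarrow> real" where
  "measure_section \<rho> V = (\<lambda>S. Re (\<rho> (the_inv_into (projections V) (alpha V) S)))"

definition pairing ::
    "('a::complex_hilbert op set \<Rightarrow> ('a op \<Rightarrow> complex) set \<Rightarrow> real) \<Rightarrow> 'a subobject
      \<Rightarrow> 'a op set \<Rightarrow> real" where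
  "pairing m S V = m V (S V)"

definition phi :: "'a::complex_hilbert op \<Rightarrow> 'a op \<Rightarrow> 'a op" where
  "phi U A = U o\<^sub>L A o\<^sub>L adj U"

text \<open>\<open>phi U ` V\<close> is $U V U^*$, and \<open>compose V l (phi U)\<close> is $\lambda\circ\phi_U|_V$.\<close>

definition phi_tilde :: "'a::complex_hilbert op \<Rightarrow> 'a subobject \<Rightarrow> 'a subobject" where
  "phi_tilde U S V = (\<lambda>l. compose V l (phi U)) ` S (phi U ` V)"

end

theory Submission
  imports Defs
begin

text \<open>
  Conjugation by \<open>U t\<close> is an isomorphism of \<open>W = U (- t) V U t\<close> onto \<open>V\<close>. Pulling characters back
  along it maps \<open>alpha V P\<close> onto \<open>alpha W (phi (U (- t)) P)\<close> (\<open>alpha_phi_image\<close>). If \<open>P\<close> is the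
  projection in \<open>V\<close> that represents the clopen set \<open>S\<^sub>0 V\<close>, the component of the rotated subobject
  at \<open>W\<close> is therefore represented by \<open>phi (U (- t)) P\<close>, and both sides of the claimed equation are
  the value of \<open>\<rho>\<^sub>0\<close> at this operator.

  The substance lies in the words ``the projection that represents'': the inverse of \<open>alpha V\<close> has
  to exist at \<open>S\<^sub>0 V\<close>, that is, \<open>alpha V\<close> has to map the projections of an abelian von Neumann
  algebra injectively to sets of characters, and onto the clopen ones. Both rest on
  \<open>spectral_cut\<close>: for self-adjoint \<open>B\<close> in \<open>V\<close> some projection \<open>Q\<close> in \<open>V\<close> has \<open>B\<close> nonnegative on its
  range and nonpositive on its kernel. This comes from the absolute value \<open>H\<close> of \<open>B\<close>, obtained by a
  norm-convergent iteration for square roots, and from the projection onto the kernel of \<open>H - B\<close>,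
  which belongs to \<open>V\<close> by the double commutant property.

  For surjectivity (\<open>alpha_surjective\<close>), cutting \<open>e\<^sup>2 - (A - a)\<^sup>2\<close> shows that the sets \<open>alpha V Q\<close> form
  a base of the topology of the spectrum. A clopen set is compact, so it is a finite union of such
  sets, and these are closed under finite unions.

  For injectivity (\<open>alpha_injective\<close>), if \<open>P\<close> and \<open>Q\<close> differ, then \<open>P (1 - Q)\<close> or \<open>Q (1 - P)\<close> is
  a nonzero projection, so it suffices to find a character with value \<open>1\<close> at a given
  nonzero projection (\<open>character_at_projection_exists\<close>). It is the limit along an ultrafilter of
  projections, in the sense that \<open>A\<close> tends to \<open>a\<close> if \<open>A - a\<close> is arbitrarily small on the ranges of
  suitable members; spectral cuts yield the existence of the limit.

  Two standard facts are proved along the way: the Riesz representation theorem, without which the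
  adjoint, being a definite description, could not be handled, and the contractivity, reality and
  positivity of characters, which are only assumed to be algebraic homomorphisms.
\<close>

section \<open>Geometry of complex Hilbert spaces\<close>

lemma scaleC_zero [simp]: "0 *\<^sub>C x = 0" and scaleC_one [simp]: "1 *\<^sub>C x = x"
  for x :: "'a::complex_hilbert"
  using scaleC_of_real[of 0 x] scaleC_of_real[of 1 x] by simp_all

lemma scaleC_minus_one: "(- 1) *\<^sub>C x = - x" for x :: "'a::complex_hilbert"
  using scaleC_of_real[of "-1" x] by simp

lemma cinner_add_left: "cinner (x + y) z = cinner x z + cinner y z"
  for x y z :: "'a::complex_hilbert"
  by (metis cinner_add_right cinner_commute complex_cnj_add)

lemma cinner_scaleR_right: "cinner x (r *\<^sub>R y) = r * cinner x y"
  for x y :: "'a::complex_hilbert"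
  by (metis cinner_scaleC_right scaleC_of_real)

lemma cinner_scaleR_left: "cinner (r *\<^sub>R x) y = r * cinner x y"
  for x y :: "'a::complex_hilbert"
  by (metis cinner_scaleC_left scaleC_of_real complex_cnj_complex_of_real)

lemma cinner_minus_right: "cinner x (- y) = - cinner x y"
  and cinner_minus_left: "cinner (- x) y = - cinner x y" for x y :: "'a::complex_hilbert"
  using cinner_scaleR_right[of x "-1" y] cinner_scaleR_left[of "-1" x y] by simp_all

lemma cinner_diff_right: "cinner x (y - z) = cinner x y - cinner x z"
  and cinner_diff_left: "cinner (y - z) x = cinner y x - cinner z x"
  for x y z :: "'a::complex_hilbert"
  by (simp_all only: diff_conv_add_uminus cinner_add_right cinner_add_left
      cinner_minus_right cinner_minus_left)

lemma cinner_zero [simp]: "cinner x 0 = 0" "cinner 0 x = 0" for x :: "'a::complex_hilbert"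
  using cinner_diff_right[of x 0 0] cinner_diff_left[of 0 0 x] by simp_all

lemmas cinner_linear = cinner_add_left cinner_add_right cinner_diff_left cinner_diff_right
  cinner_scaleC_left cinner_scaleC_right cinner_minus_left cinner_minus_right
  cinner_scaleR_left cinner_scaleR_right

lemma norm_square: "(norm x)\<^sup>2 = Re (cinner x x)" for x :: "'a::complex_hilbert"
  by (simp add: cinner_self)

lemma norm_add_square: "(norm (x + y))\<^sup>2 = (norm x)\<^sup>2 + 2 * Re (cinner x y) + (norm y)\<^sup>2"
  for x y :: "'a::complex_hilbert"
proof -
  have "Re (cinner y x) = Re (cinner x y)"
    by (subst cinner_commute) simp
  then show ?thesis
    by (simp add: norm_square cinner_linear)
qed

lemma norm_diff_square: "(norm (x - y))\<^sup>2 = (norm x)\<^sup>2 - 2 * Re (cinner x y) + (norm y)\<^sup>2"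
  for x y :: "'a::complex_hilbert"
  using norm_add_square[of x "- y"] by (simp add: cinner_minus_right)

lemma parallelogram: "(norm (x + y))\<^sup>2 + (norm (x - y))\<^sup>2 = 2 * (norm x)\<^sup>2 + 2 * (norm y)\<^sup>2"
  for x y :: "'a::complex_hilbert"
  by (simp add: norm_add_square norm_diff_square)

text \<open>The choice of \<open>c\<close> makes \<open>c *\<^sub>C y\<close> the multiple of \<open>y\<close> that is closest to \<open>x\<close>; the
  identity yields both the Cauchy--Schwarz inequality and the orthogonality of a best approximation.\<close>

lemma norm_diff_best_multiple:
  fixes x y :: "'a::complex_hilbert"
  assumes "y \<noteq> 0"
  defines "c \<equiv> cinner y x / of_real ((norm y)\<^sup>2)"
  shows "(norm (x - c *\<^sub>C y))\<^sup>2 = (norm x)\<^sup>2 - (cmod (cinner x y))\<^sup>2 / (norm y)\<^sup>2"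
proof -
  have n: "norm y \<noteq> 0"
    using assms by simp
  have c: "cmod c = cmod (cinner x y) / (norm y)\<^sup>2"
    unfolding c_def by (subst cinner_commute) (simp add: norm_divide norm_power)
  have "cinner x (c *\<^sub>C y) = of_real ((cmod (cinner x y))\<^sup>2 / (norm y)\<^sup>2)"
    unfolding cinner_scaleC_right c_def cinner_commute[of y x] of_real_divide complex_norm_square
    by (simp add: mult.commute)
  then have "Re (cinner x (c *\<^sub>C y)) = (cmod (cinner x y))\<^sup>2 / (norm y)\<^sup>2"
    by (metis Re_complex_of_real)
  moreover have "(norm (c *\<^sub>C y))\<^sup>2 = (cmod (cinner x y))\<^sup>2 / (norm y)\<^sup>2"
    using n unfolding norm_scaleC c by (simp add: power2_eq_square)
  ultimately show ?thesis
    by (simp add: norm_diff_square)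
qed

lemma cinner_Cauchy_Schwarz: "cmod (cinner x y) \<le> norm x * norm y"
  for x y :: "'a::complex_hilbert"
proof (cases "y = 0")
  case False
  then have "(cmod (cinner x y))\<^sup>2 / (norm y)\<^sup>2 \<le> (norm x)\<^sup>2"
    using norm_diff_best_multiple[of y x] zero_le_power2[of "norm (x - (cinner y x / of_real ((norm y)\<^sup>2)) *\<^sub>C y)"]
    by linarith
  then have "(cmod (cinner x y))\<^sup>2 \<le> (norm x * norm y)\<^sup>2"
    using False by (simp add: divide_simps power_mult_distrib)
  then show ?thesis
    by (simp add: power2_le_iff_abs_le)
qed simp

lemma bounded_linear_cinner_right: "bounded_linear (cinner x)" for x :: "'a::complex_hilbert"
  by (rule bounded_linear_intro[where K = "norm x"])
    (simp_all add: cinner_linear scaleR_conv_of_real cinner_Cauchy_Schwarz mult.commute[of _ "norm x"])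

lemma bounded_linear_cinner_left: "bounded_linear (\<lambda>x. cinner x y)" for y :: "'a::complex_hilbert"
  by (rule bounded_linear_intro[where K = "norm y"])
    (simp_all add: cinner_linear scaleR_conv_of_real cinner_Cauchy_Schwarz)

lemma cinner_ext:
  fixes x y :: "'a::complex_hilbert"
  assumes "\<And>z. cinner x z = cinner y z"
  shows "x = y"
proof -
  have "cinner (x - y) (x - y) = 0"
    by (simp add: cinner_diff_left assms)
  then show ?thesis
    by (simp add: cinner_self)
qed

definition closed_csubspace :: "'a::complex_hilbert set \<Rightarrow> bool" where
  "closed_csubspace M \<longleftrightarrow> closed M \<and> 0 \<in> M \<and> (\<forall>x\<in>M. \<forall>y\<in>M. x + y \<in> M) \<and>
     (\<forall>c. \<forall>x\<in>M. c *\<^sub>C x \<in> M)"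

text \<open>By the parallelogram identity the points of \<open>M\<close> whose distance to \<open>x\<close> is almost minimal lie
  close together, so completeness provides a point at minimal distance.\<close>

lemma closest_point_exists:
  fixes M :: "'a::complex_hilbert set"
  assumes M: "closed_csubspace M"
  obtains p where "p \<in> M" "\<And>m. m \<in> M \<Longrightarrow> norm (x - p) \<le> norm (x - m)"
proof -
  define D where "D = Inf ((\<lambda>m. (norm (x - m))\<^sup>2) ` M)"
  define S where "S n = {m \<in> M. (norm (x - m))\<^sup>2 \<le> D + 1 / Suc n}" for n
  have D_le: "D \<le> (norm (x - m))\<^sup>2" if "m \<in> M" for m
    unfolding D_def using that by (intro cInf_lower bdd_belowI[where m = 0]) auto
  have "\<exists>p. \<forall>n. p \<in> S n"
  proof (rule decreasing_closed_nest[of S])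
    fix n
    have "S n = M \<inter> {m. (norm (x - m))\<^sup>2 \<le> D + 1 / Suc n}"
      unfolding S_def by auto
    then show "closed (S n)"
      using M unfolding closed_csubspace_def
      by (auto intro!: closed_Int closed_Collect_le continuous_intros)
    have "D < D + 1 / Suc n"
      by simp
    then obtain m where "m \<in> M" "(norm (x - m))\<^sup>2 < D + 1 / Suc n"
      using M cInf_lessD[of "(\<lambda>m. (norm (x - m))\<^sup>2) ` M" "D + 1 / Suc n"]
      unfolding D_def closed_csubspace_def by auto
    then show "S n \<noteq> {}"
      unfolding S_def by force
  next
    fix m n :: nat
    assume "m \<le> n"
    then have "1 / real (Suc n) \<le> 1 / real (Suc m)"
      by (simp add: frac_le)
    then show "S n \<subseteq> S m"
      unfolding S_def by auto
  next
    fix e :: real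
    assume "0 < e"
    then obtain n where n: "4 / real (Suc n) < e\<^sup>2"
      using reals_Archimedean[of "e\<^sup>2 / 4"] by (auto simp: field_simps)
    have "dist a b < e" if a: "a \<in> S n" and b: "b \<in> S n" for a b
    proof -
      \<comment> \<open>the midpoint of \<open>a\<close> and \<open>b\<close>, whose squared distance to \<open>x\<close> is at least \<open>D\<close>\<close>
      define h where "h = complex_of_real (1/2) *\<^sub>C (a + b)"
      have "h \<in> M"
        using M a b unfolding closed_csubspace_def S_def h_def by auto
      have "2 *\<^sub>R (x - h) = (x - a) + (x - b)"
        unfolding h_def scaleC_of_real by (simp add: algebra_simps scaleR_2)
      then have "4 * (norm (x - h))\<^sup>2 = (norm ((x - a) + (x - b)))\<^sup>2"
        using norm_scaleR[of 2 "x - h"] by (simp add: power_mult_distrib)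
      moreover have "(norm (a - b))\<^sup>2 = (norm ((x - a) - (x - b)))\<^sup>2"
        by (simp add: norm_minus_commute)
      ultimately have "(norm (a - b))\<^sup>2
          = 2 * (norm (x - a))\<^sup>2 + 2 * (norm (x - b))\<^sup>2 - 4 * (norm (x - h))\<^sup>2"
        using parallelogram[of "x - a" "x - b"] by linarith
      also have "\<dots> \<le> 4 / Suc n"
        using a b D_le[OF \<open>h \<in> M\<close>] unfolding S_def by simp
      finally show ?thesis
        using n \<open>0 < e\<close> power_less_imp_less_base[of "dist a b" 2 e] by (simp add: dist_norm)
    qed
    then show "\<exists>n. \<forall>a\<in>S n. \<forall>b\<in>S n. dist a b < e"
      by blast
  qed blast
  then obtain p where p: "p \<in> S n" for n
    by blast
  have "(norm (x - p))\<^sup>2 \<le> D"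
  proof (rule field_le_epsilon)
    fix e :: real
    assume "0 < e"
    then obtain n where "1 / real (Suc n) < e"
      using reals_Archimedean[of e] by (auto simp: inverse_eq_divide)
    then show "(norm (x - p))\<^sup>2 \<le> D + e"
      using p[of n] unfolding S_def by auto
  qed
  then have "norm (x - p) \<le> norm (x - m)" if "m \<in> M" for m
    using D_le[OF that] by (meson norm_ge_zero order_trans power2_le_imp_le)
  with p show ?thesis
    using that unfolding S_def by blast
qed

lemma orthogonal_decomposition:
  fixes M :: "'a::complex_hilbert set"
  assumes M: "closed_csubspace M"
  obtains p where "p \<in> M" "\<And>m. m \<in> M \<Longrightarrow> cinner (x - p) m = 0"
proof -
  obtain p where p: "p \<in> M" "\<And>m. m \<in> M \<Longrightarrow> norm (x - p) \<le> norm (x - m)"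
    using closest_point_exists[OF M] by blast
  have "cinner (x - p) m = 0" if m: "m \<in> M" for m
  proof (cases "m = 0")
    case False
    define c where "c = cinner m (x - p) / of_real ((norm m)\<^sup>2)"
    have "norm (x - p) \<le> norm (x - p - c *\<^sub>C m)"
      using p(2)[of "p + c *\<^sub>C m"] M m p(1) unfolding closed_csubspace_def
      by (simp add: diff_diff_add)
    then have "(norm (x - p))\<^sup>2 \<le> (norm (x - p - c *\<^sub>C m))\<^sup>2"
      by (simp add: power_mono)
    then have "(cmod (cinner (x - p) m))\<^sup>2 / (norm m)\<^sup>2 \<le> 0"
      using norm_diff_best_multiple[OF False, of "x - p"] unfolding c_def by linarith
    then show ?thesis
      using False by (simp add: divide_le_0_iff)
  qed simp
  with p(1) show ?thesis
    using that by blast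
qed

text \<open>The Riesz representation theorem: the functional is a multiple of the inner product with a
  vector orthogonal to its kernel.\<close>

lemma Riesz_representation:
  fixes f :: "'a::complex_hilbert \<Rightarrow> complex"
  assumes f: "bounded_linear f" and f_scale: "\<And>c x. f (c *\<^sub>C x) = c * f x"
  obtains z where "\<And>y. f y = cinner z y"
proof (cases "\<forall>y. f y = 0")
  case True
  then show ?thesis
    using that[of 0] by simp
next
  case False
  then obtain x where x: "f x \<noteq> 0"
    by blast
  interpret f: bounded_linear f
    by (fact f)
  have "closed {y. f y = 0}"
    by (intro closed_Collect_eq continuous_intros f.continuous_on)
  then have M: "closed_csubspace {y. f y = 0}"
    unfolding closed_csubspace_def by (auto simp: f.add f_scale f.zero)
  obtain p where p: "f p = 0" "\<And>m. f m = 0 \<Longrightarrow> cinner (x - p) m = 0"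
    using orthogonal_decomposition[OF M, of x] by auto
  define w where "w = x - p"
  have w: "f w = f x" "\<And>m. f m = 0 \<Longrightarrow> cinner w m = 0"
    using p unfolding w_def by (auto simp: f.diff)
  with x have "w \<noteq> 0"
    by (auto simp: f.zero)
  have "f y = cinner (cnj (f w / cinner w w) *\<^sub>C w) y" for y
  proof -
    have "f (y - (f y / f w) *\<^sub>C w) = 0"
      using x w(1) by (simp add: f.diff f_scale)
    then have "cinner w (y - (f y / f w) *\<^sub>C w) = 0"
      by (rule w(2))
    then have "cinner w y = f y / f w * cinner w w"
      by (simp add: cinner_linear)
    then show ?thesis
      using x w(1) \<open>w \<noteq> 0\<close> by (simp add: cinner_linear cinner_self)
  qed
  then show ?thesis
    by (rule that)
qed

section \<open>Operators and their adjoints\<close>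

lemmas op_apply = plus_blinfun.rep_eq minus_blinfun.rep_eq uminus_blinfun.rep_eq
  scale_op.rep_eq zero_blinfun.rep_eq

lemma blinfun_compose_assoc: "(A o\<^sub>L B) o\<^sub>L C = A o\<^sub>L (B o\<^sub>L C)"
  by (rule blinfun_eqI) simp

lemma id_compose [simp]: "id_blinfun o\<^sub>L A = A" "A o\<^sub>L id_blinfun = A"
  by (auto intro!: blinfun_eqI)

lemmas compose_distrib = bounded_bilinear.add_left[OF bounded_bilinear_blinfun_compose]
  bounded_bilinear.add_right[OF bounded_bilinear_blinfun_compose]
  bounded_bilinear.diff_left[OF bounded_bilinear_blinfun_compose]
  bounded_bilinear.diff_right[OF bounded_bilinear_blinfun_compose]

lemma bounded_ops_scaleC: "A \<in> bounded_ops \<Longrightarrow> A (c *\<^sub>C x) = c *\<^sub>C A x"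
  unfolding bounded_ops_def by blast

lemma scaleC_diff_right: "c *\<^sub>C (x - y) = c *\<^sub>C x - c *\<^sub>C y" for x y :: "'a::complex_hilbert"
  using scaleC_add_right[of c "x - y" y] by simp

lemma scaleC_minus_left: "(- c) *\<^sub>C x = - (c *\<^sub>C x)" for x :: "'a::complex_hilbert"
  using scaleC_scaleC[of "- 1" c x] by (simp add: scaleC_minus_one)

lemma scaleC_commute: "c *\<^sub>C d *\<^sub>C x = d *\<^sub>C c *\<^sub>C x" for x :: "'a::complex_hilbert"
  by (simp add: scaleC_scaleC mult.commute)

lemma id_in_bounded_ops: "id_blinfun \<in> bounded_ops"
  and add_in_bounded_ops: "A \<in> bounded_ops \<Longrightarrow> B \<in> bounded_ops \<Longrightarrow> A + B \<in> bounded_ops"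
  and diff_in_bounded_ops: "A \<in> bounded_ops \<Longrightarrow> B \<in> bounded_ops \<Longrightarrow> A - B \<in> bounded_ops"
  and compose_in_bounded_ops: "A \<in> bounded_ops \<Longrightarrow> B \<in> bounded_ops \<Longrightarrow> A o\<^sub>L B \<in> bounded_ops"
  and scale_in_bounded_ops: "A \<in> bounded_ops \<Longrightarrow> scale_op c A \<in> bounded_ops"
  unfolding bounded_ops_def
  by (auto simp: op_apply scaleC_add_right scaleC_diff_right scaleC_commute)

lemma scale_op_of_real: "scale_op (complex_of_real r) A = r *\<^sub>R A"
  by (rule blinfun_eqI) (simp add: op_apply scaleR_blinfun.rep_eq scaleC_of_real)

lemma norm_scale_op: "norm (scale_op c A) \<le> cmod c * norm A"
proof (rule norm_blinfun_bound)
  fix x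
  have "cmod c * norm (A x) \<le> cmod c * (norm A * norm x)"
    by (simp add: mult_left_mono norm_blinfun)
  then show "norm (scale_op c A x) \<le> cmod c * norm A * norm x"
    by (simp add: op_apply norm_scaleC mult.assoc)
qed simp

lemma adj_eqI:
  fixes A B :: "'a::complex_hilbert op"
  assumes "\<And>x y. cinner (B x) y = cinner x (A y)"
  shows "adj A = B"
  unfolding adj_def
proof (rule the_equality)
  show "\<forall>x y. cinner (B x) y = cinner x (A y)"
    using assms by blast
  fix C :: "'a op"
  assume "\<forall>x y. cinner (C x) y = cinner x (A y)"
  then show "C = B"
    by (intro blinfun_eqI cinner_ext) (simp add: assms)
qed

text \<open>The definite description defining \<^const>\<open>adj\<close> has a referent for complex-linear operators,
  by the Riesz representation theorem.\<close>

lemma cinner_adj_left: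
  fixes A :: "'a::complex_hilbert op"
  assumes A: "A \<in> bounded_ops"
  shows "cinner (adj A x) y = cinner x (A y)"
proof -
  have "\<exists>z. \<forall>y. cinner x (A y) = cinner z y" for x
  proof -
    have "bounded_linear (\<lambda>y. cinner x (A y))"
      by (intro bounded_linear_compose[OF bounded_linear_cinner_right] blinfun.bounded_linear_right)
    moreover have "cinner x (A (c *\<^sub>C y)) = c * cinner x (A y)" for c y
      by (simp add: bounded_ops_scaleC[OF A] cinner_scaleC_right)
    ultimately obtain z where "cinner x (A y) = cinner z y" for y
      using Riesz_representation[of "\<lambda>y. cinner x (A y)"] by blast
    then show ?thesis
      by blast
  qed
  then obtain B where "\<forall>x y. cinner x (A y) = cinner (B x) y"
    using choice[of "\<lambda>x z. \<forall>y. cinner x (A y) = cinner z y"] by blast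
  then have B: "cinner x (A y) = cinner (B x) y" for x y
    by blast
  have add: "B (x + y) = B x + B y" for x y
    by (rule cinner_ext) (simp add: B[symmetric] cinner_linear)
  have scaleR: "B (r *\<^sub>R x) = r *\<^sub>R B x" for r x
    by (rule cinner_ext) (simp add: B[symmetric] cinner_linear)
  have bound: "norm (B x) \<le> norm x * norm A" for x
  proof (cases "B x = 0")
    case False
    have "norm (B x) * norm (B x) = cmod (cinner x (A (B x)))"
      by (simp add: B cinner_self norm_mult power2_eq_square)
    also have "\<dots> \<le> norm x * norm (A (B x))"
      by (rule cinner_Cauchy_Schwarz)
    also have "\<dots> \<le> norm x * (norm A * norm (B x))"
      by (intro mult_left_mono norm_blinfun) simp
    finally show ?thesis
      using False by simp
  qed simp
  have "bounded_linear B"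
    using add scaleR bound by (rule bounded_linear_intro)
  then have "blinfun_apply (Blinfun B) = B"
    by (rule bounded_linear_Blinfun_apply)
  then have "adj A = Blinfun B"
    by (intro adj_eqI) (simp add: B)
  with \<open>blinfun_apply (Blinfun B) = B\<close> show ?thesis
    by (simp add: B)
qed

lemma cinner_adj_right: "A \<in> bounded_ops \<Longrightarrow> cinner x (adj A y) = cinner (A x) y"
  using cinner_adj_left[of A y x] cinner_commute[of x "adj A y"] cinner_commute[of "A x" y] by simp

lemma adj_in_bounded_ops:
  assumes "A \<in> bounded_ops"
  shows "adj A \<in> bounded_ops"
proof -
  have "adj A (c *\<^sub>C x) = c *\<^sub>C adj A x" for c x
    by (rule cinner_ext) (simp add: assms cinner_adj_left cinner_linear)
  then show ?thesis
    unfolding bounded_ops_def by blast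
qed

lemma adj_adj: "A \<in> bounded_ops \<Longrightarrow> adj (adj A) = A"
  by (intro adj_eqI) (simp add: cinner_adj_right)

lemma adj_compose: "A \<in> bounded_ops \<Longrightarrow> B \<in> bounded_ops \<Longrightarrow> adj (A o\<^sub>L B) = adj B o\<^sub>L adj A"
  by (intro adj_eqI) (simp add: cinner_adj_left)

lemma adj_add: "A \<in> bounded_ops \<Longrightarrow> B \<in> bounded_ops \<Longrightarrow> adj (A + B) = adj A + adj B"
  by (intro adj_eqI) (simp add: cinner_adj_left op_apply cinner_linear)

lemma adj_diff: "A \<in> bounded_ops \<Longrightarrow> B \<in> bounded_ops \<Longrightarrow> adj (A - B) = adj A - adj B"
  by (intro adj_eqI) (simp add: cinner_adj_left op_apply cinner_linear)

lemma adj_scale: "A \<in> bounded_ops \<Longrightarrow> adj (scale_op c A) = scale_op (cnj c) (adj A)"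
  by (intro adj_eqI) (simp add: cinner_adj_left op_apply cinner_linear)

lemma adj_id [simp]: "adj id_blinfun = id_blinfun"
  by (intro adj_eqI) simp

definition selfadjoint :: "'a::complex_hilbert op \<Rightarrow> bool" where
  "selfadjoint A \<longleftrightarrow> A \<in> bounded_ops \<and> adj A = A"

lemma selfadjoint_cinner: "selfadjoint A \<Longrightarrow> cinner (A x) y = cinner x (A y)"
  unfolding selfadjoint_def by (metis cinner_adj_left)

lemma selfadjointI:
  assumes "A \<in> bounded_ops" "\<And>x y. cinner (A x) y = cinner x (A y)"
  shows "selfadjoint A"
  using assms unfolding selfadjoint_def by (blast intro: adj_eqI)

lemma selfadjoint_id: "selfadjoint id_blinfun"
  unfolding selfadjoint_def by (simp add: id_in_bounded_ops)

lemma selfadjoint_add: "selfadjoint A \<Longrightarrow> selfadjoint B \<Longrightarrow> selfadjoint (A + B)"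
  and selfadjoint_diff: "selfadjoint A \<Longrightarrow> selfadjoint B \<Longrightarrow> selfadjoint (A - B)"
  unfolding selfadjoint_def
  by (simp_all add: add_in_bounded_ops diff_in_bounded_ops adj_add adj_diff)

lemma selfadjoint_scale: "selfadjoint A \<Longrightarrow> selfadjoint (scale_op (of_real r) A)"
  unfolding selfadjoint_def by (simp add: scale_in_bounded_ops adj_scale)

lemma selfadjoint_scaleR: "selfadjoint A \<Longrightarrow> selfadjoint (r *\<^sub>R A)"
  using selfadjoint_scale[of A r] by (simp only: scale_op_of_real)

lemma selfadjoint_compose:
  "selfadjoint A \<Longrightarrow> selfadjoint B \<Longrightarrow> A o\<^sub>L B = B o\<^sub>L A \<Longrightarrow> selfadjoint (A o\<^sub>L B)"
  unfolding selfadjoint_def by (simp add: compose_in_bounded_ops adj_compose)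

lemma selfadjoint_cinner_real: "selfadjoint A \<Longrightarrow> cinner x (A x) \<in> \<real>"
  unfolding Reals_cnj_iff by (subst (2) selfadjoint_cinner[symmetric]) (simp_all flip: cinner_commute)

text \<open>Polarization turns the bound on the quadratic form into a bound on \<open>Re (cinner y (A x))\<close>; the
  multiple of \<open>A x\<close> that has the length of \<open>x\<close> is the best choice of \<open>y\<close>.\<close>

lemma norm_le_quadratic_form:
  fixes A :: "'a::complex_hilbert op"
  assumes A: "selfadjoint A"
    and all: "\<And>x. \<bar>Re (cinner x (A x))\<bar> \<le> e * (norm x)\<^sup>2"
  shows "norm (A x) \<le> e * norm x"
proof (cases "A x = 0")
  case True
  have "0 \<le> e" if "x \<noteq> 0"
  proof -
    have "0 \<le> e * (norm x)\<^sup>2"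
      using all[of x] by linarith
    with that show ?thesis
      by (simp add: zero_le_mult_iff)
  qed
  with True show ?thesis
    by (cases "x = 0") auto
next
  case False
  then have "x \<noteq> 0"
    by auto
  define y where "y = (norm x / norm (A x)) *\<^sub>R A x"
  have ny: "norm y = norm x"
    using False by (simp add: y_def)
  have "Re (cinner x (A y)) = Re (cinner y (A x))"
    by (subst cinner_commute) (simp add: selfadjoint_cinner[OF A])
  then have "4 * Re (cinner y (A x))
      = Re (cinner (x + y) (A (x + y))) - Re (cinner (x - y) (A (x - y)))"
    by (simp add: blinfun.add_right blinfun.diff_right cinner_linear)
  also have "\<dots> \<le> e * (norm (x + y))\<^sup>2 + e * (norm (x - y))\<^sup>2"
    using all[of "x + y"] all[of "x - y"] by linarith
  also have "\<dots> = 4 * e * (norm x)\<^sup>2"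
    using parallelogram[of x y] ny by (simp flip: distrib_left)
  finally have "Re (cinner y (A x)) \<le> e * (norm x)\<^sup>2"
    by simp
  moreover have "Re (cinner y (A x)) = norm x * norm (A x)"
    using False by (simp add: y_def cinner_linear cinner_self power2_eq_square)
  ultimately show ?thesis
    using \<open>x \<noteq> 0\<close> by (simp add: power2_eq_square)
qed

lemma bounded_linear_scaleC: "bounded_linear (\<lambda>x::'a::complex_hilbert. c *\<^sub>C x)"
  by (rule bounded_linear_intro[where K = "cmod c"])
    (simp_all add: scaleC_add_right norm_scaleC mult.commute scaleC_of_real[symmetric] scaleC_scaleC)

lemma tendsto_op_apply: "X \<longlonglongrightarrow> A \<Longrightarrow> (\<lambda>n. blinfun_apply (X n) x) \<longlonglongrightarrow> A x"
  by (intro blinfun.tendsto tendsto_const)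

lemma LIMSEQ_in_bounded_ops:
  assumes "\<And>n. X n \<in> bounded_ops" "X \<longlonglongrightarrow> A"
  shows "A \<in> bounded_ops"
proof -
  have "A (c *\<^sub>C x) = c *\<^sub>C A x" for c x
  proof (rule LIMSEQ_unique)
    show "(\<lambda>n. X n (c *\<^sub>C x)) \<longlonglongrightarrow> A (c *\<^sub>C x)"
      by (rule tendsto_op_apply[OF assms(2)])
    show "(\<lambda>n. X n (c *\<^sub>C x)) \<longlonglongrightarrow> c *\<^sub>C A x"
      unfolding bounded_ops_scaleC[OF assms(1)]
      by (intro bounded_linear.tendsto[OF bounded_linear_scaleC] tendsto_op_apply assms(2))
  qed
  then show ?thesis
    unfolding bounded_ops_def by blast
qed

lemma LIMSEQ_selfadjoint:
  assumes "\<And>n. selfadjoint (X n)" "X \<longlonglongrightarrow> A"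
  shows "selfadjoint A"
proof (rule selfadjointI)
  show "A \<in> bounded_ops"
    using assms LIMSEQ_in_bounded_ops unfolding selfadjoint_def by blast
  show "cinner (A x) y = cinner x (A y)" for x y
  proof (rule LIMSEQ_unique)
    show "(\<lambda>n. cinner (X n x) y) \<longlonglongrightarrow> cinner (A x) y"
      by (intro bounded_linear.tendsto[OF bounded_linear_cinner_left] tendsto_op_apply assms(2))
    show "(\<lambda>n. cinner (X n x) y) \<longlonglongrightarrow> cinner x (A y)"
      unfolding selfadjoint_cinner[OF assms(1)]
      by (intro bounded_linear.tendsto[OF bounded_linear_cinner_right] tendsto_op_apply assms(2))
  qed
qed

text \<open>The last property holds because \<open>D\<close> also maps the orthogonal complement of \<open>M\<close> to itself if
  \<open>adj D\<close> leaves \<open>M\<close> invariant.\<close>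

lemma orthogonal_projection_exists:
  fixes M :: "'a::complex_hilbert set"
  assumes M: "closed_csubspace M"
  obtains Q where "Q \<in> bounded_ops" "Q o\<^sub>L Q = Q" "adj Q = Q"
    "\<And>x. Q x \<in> M" "\<And>x. x \<in> M \<Longrightarrow> Q x = x"
    "\<And>D. D \<in> bounded_ops \<Longrightarrow> (\<And>x. x \<in> M \<Longrightarrow> D x \<in> M) \<Longrightarrow> (\<And>x. x \<in> M \<Longrightarrow> adj D x \<in> M)
      \<Longrightarrow> Q o\<^sub>L D = D o\<^sub>L Q"
proof -
  have Madd: "x + y \<in> M" if "x \<in> M" "y \<in> M" for x y
    using M that unfolding closed_csubspace_def by blast
  have Mscale: "c *\<^sub>C x \<in> M" if "x \<in> M" for c x
    using M that unfolding closed_csubspace_def by blast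
  have Mdiff: "x - y \<in> M" if "x \<in> M" "y \<in> M" for x y
    using Madd[OF that(1) Mscale[OF that(2), of "-1"]] by (simp add: scaleC_minus_one)
  define q where "q x = (SOME p. p \<in> M \<and> (\<forall>m\<in>M. cinner (x - p) m = 0))" for x
  have "q x \<in> M \<and> (\<forall>m\<in>M. cinner (x - q x) m = 0)" for x
    unfolding q_def
  proof (rule someI_ex)
    show "\<exists>p. p \<in> M \<and> (\<forall>m\<in>M. cinner (x - p) m = 0)"
      by (rule orthogonal_decomposition[OF M, of x]) blast
  qed
  then have q: "q x \<in> M" "m \<in> M \<Longrightarrow> cinner (x - q x) m = 0" for x m
    by simp_all
  have cinner_q: "cinner (q x) m = cinner x m" if "m \<in> M" for x m
    using q(2)[OF that, of x] by (simp add: cinner_diff_left)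
  have unique: "q x = p" if "p \<in> M" "\<And>m. m \<in> M \<Longrightarrow> cinner (x - p) m = 0" for x p
  proof -
    have "q x - p \<in> M"
      by (intro Mdiff q that)
    then have "cinner (x - p) (q x - p) - cinner (x - q x) (q x - p) = 0"
      by (simp only: q(2) that(2) diff_self)
    then have "cinner (q x - p) (q x - p) = 0"
      by (simp add: cinner_diff_left)
    then show ?thesis
      by (simp add: cinner_self)
  qed
  have q_id: "q x = x" if "x \<in> M" for x
    using that by (intro unique) simp_all
  have q_add: "q (x + y) = q x + q y" for x y
    by (intro unique Madd q) (simp add: cinner_linear cinner_q)
  have q_scale: "q (c *\<^sub>C x) = c *\<^sub>C q x" for c x
    by (intro unique Mscale q) (simp add: cinner_linear cinner_q)
  have q_norm: "norm (q x) \<le> norm x * 1" for x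
  proof -
    have "(norm x)\<^sup>2 = (norm ((x - q x) + q x))\<^sup>2"
      by simp
    also have "\<dots> = (norm (x - q x))\<^sup>2 + (norm (q x))\<^sup>2"
      unfolding norm_add_square by (simp add: q)
    finally have "(norm (q x))\<^sup>2 \<le> (norm x)\<^sup>2"
      by simp
    then show ?thesis
      by (simp add: power2_le_iff_abs_le)
  qed
  have "bounded_linear q"
    using q_add _ q_norm
  proof (rule bounded_linear_intro)
    show "q (r *\<^sub>R x) = r *\<^sub>R q x" for r x
      using q_scale[of "complex_of_real r" x] by (simp only: scaleC_of_real)
  qed
  then have Q: "blinfun_apply (Blinfun q) = q"
    by (rule bounded_linear_Blinfun_apply)
  have q_sym: "cinner (q x) y = cinner x (q y)" for x y
  proof -
    have "cinner (q x) (y - q y) = 0"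
      by (subst cinner_commute) (simp add: q)
    moreover have "cinner (x - q x) (q y) = 0"
      by (simp add: q)
    ultimately show ?thesis
      by (simp add: cinner_linear)
  qed
  show ?thesis
  proof (rule that[of "Blinfun q"])
    show "Blinfun q \<in> bounded_ops"
      unfolding bounded_ops_def by (simp add: Q q_scale)
    show "Blinfun q o\<^sub>L Blinfun q = Blinfun q"
      by (rule blinfun_eqI) (simp add: Q q_id q)
    show "adj (Blinfun q) = Blinfun q"
      by (rule adj_eqI) (simp add: Q q_sym)
    show "Blinfun q x \<in> M" for x
      by (simp add: Q q)
    show "Blinfun q x = x" if "x \<in> M" for x
      by (simp add: Q q_id that)
    fix D :: "'a op"
    assume D: "D \<in> bounded_ops" "\<And>x. x \<in> M \<Longrightarrow> D x \<in> M" "\<And>x. x \<in> M \<Longrightarrow> adj D x \<in> M"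
    have "q (D x) = D (q x)" for x
    proof (rule unique)
      show "D (q x) \<in> M"
        by (intro D q)
      show "cinner (D x - D (q x)) m = 0" if "m \<in> M" for m
        using q(2)[OF D(3)[OF that], of x] cinner_adj_right[OF D(1), of "x - q x" m]
        by (simp add: blinfun.diff_right)
    qed
    then show "Blinfun q o\<^sub>L D = D o\<^sub>L Blinfun q"
      by (intro blinfun_eqI) (simp add: Q)
  qed
qed


section \<open>Abelian von Neumann algebras\<close>

locale abelian_von_neumann_algebra =
  fixes V :: "'a::complex_hilbert op set"
  assumes von_neumann: "von_neumann_algebra V" and commuting: "commuting V"
begin

lemma bounded: "A \<in> V \<Longrightarrow> A \<in> bounded_ops"
  and adj_closed: "A \<in> V \<Longrightarrow> adj A \<in> V"
  using von_neumann unfolding von_neumann_algebra_def by blast+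

lemma commute: "A \<in> V \<Longrightarrow> B \<in> V \<Longrightarrow> A o\<^sub>L B = B o\<^sub>L A"
  using commuting unfolding commuting_def by blast

lemma commute_commutant: "A \<in> V \<Longrightarrow> D \<in> commutant V \<Longrightarrow> A o\<^sub>L D = D o\<^sub>L A"
  unfolding commutant_def by simp

lemma memI:
  assumes "A \<in> bounded_ops" "\<And>D. D \<in> commutant V \<Longrightarrow> A o\<^sub>L D = D o\<^sub>L A"
  shows "A \<in> V"
proof -
  have "A \<in> commutant (commutant V)"
    using assms unfolding commutant_def[of "commutant V"] by blast
  then show ?thesis
    using von_neumann unfolding von_neumann_algebra_def by simp
qed

lemma id_closed: "id_blinfun \<in> V"
  by (rule memI) (simp_all add: id_in_bounded_ops)

lemma add_closed: "A \<in> V \<Longrightarrow> B \<in> V \<Longrightarrow> A + B \<in> V"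
  and diff_closed: "A \<in> V \<Longrightarrow> B \<in> V \<Longrightarrow> A - B \<in> V"
  by (simp_all add: memI bounded add_in_bounded_ops diff_in_bounded_ops compose_distrib
      commute_commutant)

lemma compose_closed:
  assumes "A \<in> V" "B \<in> V"
  shows "A o\<^sub>L B \<in> V"
proof (rule memI)
  show "A o\<^sub>L B \<in> bounded_ops"
    using assms by (simp add: bounded compose_in_bounded_ops)
  fix D
  assume "D \<in> commutant V"
  with assms have "A o\<^sub>L D = D o\<^sub>L A" "B o\<^sub>L D = D o\<^sub>L B"
    by (blast intro: commute_commutant)+
  then show "(A o\<^sub>L B) o\<^sub>L D = D o\<^sub>L (A o\<^sub>L B)"
    by (metis blinfun_compose_assoc)
qed

lemma scale_closed:
  assumes "A \<in> V"
  shows "scale_op c A \<in> V"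
proof (rule memI)
  show "scale_op c A \<in> bounded_ops"
    by (simp add: assms bounded scale_in_bounded_ops)
  fix D
  assume D: "D \<in> commutant V"
  then have "D \<in> bounded_ops"
    unfolding commutant_def by blast
  moreover have "A (D x) = D (A x)" for x
    using commute_commutant[OF assms D] by (metis blinfun_apply_blinfun_compose)
  ultimately show "scale_op c A o\<^sub>L D = D o\<^sub>L scale_op c A"
    by (intro blinfun_eqI) (simp add: op_apply bounded_ops_scaleC)
qed

lemma scaleR_closed: "A \<in> V \<Longrightarrow> r *\<^sub>R A \<in> V"
  using scale_closed[of A "of_real r"] by (simp add: scale_op_of_real)

lemma limit_closed:
  assumes "\<And>n. X n \<in> V" "X \<longlonglongrightarrow> A"
  shows "A \<in> V"
proof (rule memI)
  show "A \<in> bounded_ops"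
    using assms bounded LIMSEQ_in_bounded_ops by blast
  fix D
  assume D: "D \<in> commutant V"
  show "A o\<^sub>L D = D o\<^sub>L A"
  proof (rule LIMSEQ_unique)
    show "(\<lambda>n. X n o\<^sub>L D) \<longlonglongrightarrow> (A o\<^sub>L D)"
      by (intro bounded_bilinear.tendsto[OF bounded_bilinear_blinfun_compose] assms tendsto_const)
    show "(\<lambda>n. X n o\<^sub>L D) \<longlonglongrightarrow> (D o\<^sub>L A)"
      unfolding commute_commutant[OF assms(1) D]
      by (intro bounded_bilinear.tendsto[OF bounded_bilinear_blinfun_compose] assms tendsto_const)
  qed
qed

lemma adj_commutant:
  assumes D: "D \<in> commutant V"
  shows "adj D \<in> commutant V"
proof -
  have Db: "D \<in> bounded_ops"
    using D unfolding commutant_def by blast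
  have "adj D o\<^sub>L B = B o\<^sub>L adj D" if B: "B \<in> V" for B
  proof -
    have "adj (adj B o\<^sub>L D) = adj (D o\<^sub>L adj B)"
      using commute_commutant[OF adj_closed[OF B] D] by simp
    then show ?thesis
      using Db B by (simp add: adj_compose bounded adj_closed adj_adj)
  qed
  then show ?thesis
    using Db unfolding commutant_def by (simp add: adj_in_bounded_ops)
qed

lemma projections_selfadjoint: "P \<in> projections V \<Longrightarrow> selfadjoint P"
  unfolding projections_def selfadjoint_def by (simp add: bounded)

text \<open>The kernel of \<open>A\<close> is invariant under the self-adjoint set \<open>commutant V\<close>, so the projection
  onto it commutes with \<open>commutant V\<close>.\<close>

lemma kernel_projection:
  assumes A: "A \<in> V"
  obtains Q where "Q \<in> projections V" "\<And>x. A x = 0 \<longleftrightarrow> Q x = x"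
proof -
  have "closed {x. A x = 0}"
    by (intro closed_Collect_eq continuous_intros)
  then have M: "closed_csubspace {x. A x = 0}"
    unfolding closed_csubspace_def
    using bounded_ops_scaleC[OF bounded[OF A]] scaleC_of_real[of 0]
    by (auto simp: blinfun.add_right) (metis scaleC_scaleC mult_zero_right scaleC_zero)
  obtain Q where Q: "Q \<in> bounded_ops" "Q o\<^sub>L Q = Q" "adj Q = Q"
    "\<And>x. A (Q x) = 0" "\<And>x. A x = 0 \<Longrightarrow> Q x = x"
    and comm: "\<And>D. D \<in> bounded_ops \<Longrightarrow> (\<And>x. A x = 0 \<Longrightarrow> A (D x) = 0) \<Longrightarrow>
      (\<And>x. A x = 0 \<Longrightarrow> A (adj D x) = 0) \<Longrightarrow> Q o\<^sub>L D = D o\<^sub>L Q"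
    using orthogonal_projection_exists[OF M] unfolding mem_Collect_eq by metis
  have inv: "A (D x) = 0" if "D \<in> commutant V" "A x = 0" for D x
    using commute_commutant[OF A that(1)] that(2)
    by (metis blinfun_apply_blinfun_compose blinfun.zero_right)
  have "Q \<in> V"
  proof (rule memI)
    fix D
    assume D: "D \<in> commutant V"
    then have "D \<in> bounded_ops"
      unfolding commutant_def by blast
    then show "Q o\<^sub>L D = D o\<^sub>L Q"
      using inv[OF D] inv[OF adj_commutant[OF D]] by (intro comm)
  qed (fact Q)
  show ?thesis
  proof (rule that)
    show "Q \<in> projections V"
      using Q \<open>Q \<in> V\<close> unfolding projections_def by simp
    show "A x = 0 \<longleftrightarrow> Q x = x" for x
      using Q(4)[of x] Q(5)[of x] by auto
  qed
qed

text \<open>The required equation says that \<open>Y = (X + Y\<^sup>2) / 2\<close>. The iteration starting at \<open>0\<close> is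
  dominated term by term by the scalar iteration for \<open>1 = norm X\<close>, which is increasing and bounded.\<close>

lemma square_root_of_id_minus_contraction:
  assumes X: "X \<in> V" "selfadjoint X" "norm X \<le> 1"
  obtains Y where "Y \<in> V" "selfadjoint Y" "norm Y \<le> 1"
    "(id_blinfun - Y) o\<^sub>L (id_blinfun - Y) = id_blinfun - X"
proof -
  define Y where "Y n = ((\<lambda>Y. (1/2) *\<^sub>R (X + (Y o\<^sub>L Y))) ^^ n) 0" for n
  define y where "y n = ((\<lambda>y. (1/2) * (1 + y * y)) ^^ n) (0::real)" for n
  have Y0: "Y 0 = 0" and YS: "Y (Suc n) = (1/2) *\<^sub>R (X + (Y n o\<^sub>L Y n))" for n
    by (simp_all add: Y_def)
  have y0: "y 0 = 0" and yS: "y (Suc n) = (1/2) * (1 + y n * y n)" for n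
    by (simp_all add: y_def)
  have Y: "Y n \<in> V \<and> selfadjoint (Y n)" for n
  proof (induction n)
    case 0
    show ?case
      using diff_closed[OF id_closed id_closed] selfadjoint_diff[OF selfadjoint_id selfadjoint_id]
      by (simp add: Y0)
  next
    case (Suc n)
    then show ?case
      unfolding YS using X selfadjoint_scale[of "X + (Y n o\<^sub>L Y n)" "1/2"]
      by (simp add: scaleR_closed add_closed compose_closed selfadjoint_add selfadjoint_compose
          scale_op_of_real del: of_real_divide)
  qed
  have y: "0 \<le> y n \<and> y n \<le> 1" for n
  proof (induction n)
    case (Suc n)
    then have "y n * y n \<le> 1"
      by (simp add: mult_le_one)
    with Suc show ?case
      by (simp add: yS)
  qed (simp add: y0)
  have norm_Y: "norm (Y n) \<le> y n" for n
  proof (induction n)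
    case (Suc n)
    have "norm (Y n o\<^sub>L Y n) \<le> y n * y n"
      using norm_blinfun_compose[of "Y n" "Y n"] mult_mono[OF Suc Suc _ norm_ge_zero] y[of n] by simp
    then have "norm (X + (Y n o\<^sub>L Y n)) \<le> 1 + y n * y n"
      using X(3) norm_triangle_ineq[of X "Y n o\<^sub>L Y n"] by linarith
    then show ?case
      by (simp add: YS yS)
  qed (simp add: y0 Y0)
  have norm_diff: "norm (Y (Suc n) - Y n) \<le> y (Suc n) - y n" for n
  proof (induction n)
    case 0
    show ?case
      using X(3) by (simp add: YS yS Y0 y0)
  next
    case (Suc n)
    define Z where "Z = Y (Suc n) - Y n"
    define z where "z = y (Suc n) - y n"
    have "Y (Suc (Suc n)) - Y (Suc n)
        = (1/2) *\<^sub>R (X + (Y (Suc n) o\<^sub>L Y (Suc n))) - (1/2) *\<^sub>R (X + (Y n o\<^sub>L Y n))"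
      by (simp only: YS[of "Suc n", symmetric] YS[of n, symmetric])
    also have "\<dots> = (1/2) *\<^sub>R ((Y (Suc n) o\<^sub>L Y (Suc n)) - (Y n o\<^sub>L Y n))"
      by (simp add: scaleR_add_right scaleR_diff_right)
    also have "(Y (Suc n) o\<^sub>L Y (Suc n)) - (Y n o\<^sub>L Y n) = (Y (Suc n) o\<^sub>L Z) + (Z o\<^sub>L Y n)"
      unfolding Z_def by (simp add: compose_distrib)
    also have "norm ((1/2) *\<^sub>R ((Y (Suc n) o\<^sub>L Z) + (Z o\<^sub>L Y n))) \<le> (1/2) * (y (Suc n) * z + z * y n)"
    proof -
      have "norm (Y (Suc n) o\<^sub>L Z) \<le> y (Suc n) * z" "norm (Z o\<^sub>L Y n) \<le> z * y n"
        using Suc y norm_Y unfolding Z_def[symmetric] z_def[symmetric]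
        by (meson norm_blinfun_compose order_trans mult_mono norm_ge_zero)+
      then show ?thesis
        using norm_triangle_ineq[of "Y (Suc n) o\<^sub>L Z" "Z o\<^sub>L Y n"] by simp
    qed
    also have "\<dots> = y (Suc (Suc n)) - y (Suc n)"
      unfolding z_def by (subst (4) yS, subst (3) yS) (simp add: algebra_simps yS)
    finally show ?case .
  qed
  have "incseq y"
    using order_trans[OF norm_ge_zero norm_diff] by (intro incseq_SucI) simp
  then have "convergent y"
    using y by (metis Bseq_mono_convergent BseqI' abs_of_nonneg real_norm_def incseq_def)
  then have "summable (\<lambda>n. y (Suc n) - y n)"
    by (auto simp: convergent_def intro: telescope_summable)
  then have "summable (\<lambda>n. Y (Suc n) - Y n)"
    by (rule summable_comparison_test') (rule norm_diff)
  then have "convergent (\<lambda>n. \<Sum>i<n. Y (Suc i) - Y i)"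
    by (simp add: summable_iff_convergent)
  then obtain L where L: "Y \<longlonglongrightarrow> L"
    unfolding sum_lessThan_telescope by (auto simp: Y0 convergent_def)
  have "(\<lambda>n. Y (Suc n)) \<longlonglongrightarrow> (1/2) *\<^sub>R (X + (L o\<^sub>L L))"
    unfolding YS
    by (intro tendsto_intros bounded_bilinear.tendsto[OF bounded_bilinear_blinfun_compose] L)
  then have "L = (1/2) *\<^sub>R (X + (L o\<^sub>L L))"
    using LIMSEQ_Suc[OF L] LIMSEQ_unique by blast
  then have "2 *\<^sub>R L = X + (L o\<^sub>L L)"
    by (metis scaleR_half_double scaleR_scaleR scaleR_2 scaleR_add_right)
  then have "(id_blinfun - L) o\<^sub>L (id_blinfun - L) = id_blinfun - X"
    by (simp add: compose_distrib scaleR_2 algebra_simps)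
  moreover have "norm L \<le> 1"
    using norm_Y y by (intro LIMSEQ_le_const2[OF tendsto_norm[OF L]]) (meson order_trans)
  moreover have "L \<in> V" "selfadjoint L"
    using limit_closed[OF _ L] LIMSEQ_selfadjoint[OF _ L] Y by blast+
  ultimately show ?thesis
    using that by blast
qed

text \<open>With \<open>H\<close> the absolute value of the rescaled operator \<open>C\<close>, the projection onto the kernel of
  \<open>H - C\<close> separates the nonnegative part of \<open>B\<close> from its negative part, since
  \<open>(H - C) (H + C) = 0\<close>.\<close>

lemma spectral_cut:
  assumes B: "B \<in> V" "selfadjoint B"
  obtains Q where "Q \<in> projections V" "\<And>x. Q x = x \<Longrightarrow> 0 \<le> Re (cinner x (B x))"
    "\<And>x. Q x = 0 \<Longrightarrow> Re (cinner x (B x)) \<le> 0"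
proof -
  define k where "k = norm B + 1"
  have k: "0 < k" "norm B \<le> k"
    using norm_ge_zero[of B] unfolding k_def by linarith+
  define C where "C = (1/k) *\<^sub>R B"
  have C: "C \<in> V" "selfadjoint C" "norm C \<le> 1"
    using B k selfadjoint_scale[of B "1/k"] unfolding C_def scale_op_of_real
    by (simp_all add: scaleR_closed)
  have BC: "Re (cinner x (B x)) = k * Re (cinner x (C x))" for x
    unfolding C_def using k by (simp add: scaleR_blinfun.rep_eq cinner_linear)
  \<comment> \<open>\<open>H = sqrt (id_blinfun - X)\<close> is then the absolute value of \<open>C\<close>.\<close>
  define X where "X = id_blinfun - (C o\<^sub>L C)"
  have X: "X \<in> V" "selfadjoint X"
    using C unfolding X_def
    by (simp_all add: diff_closed id_closed compose_closed selfadjoint_diff selfadjoint_id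
        selfadjoint_compose)
  have "norm X \<le> 1"
  proof (rule norm_blinfun_bound)
    fix x
    have contract: "(norm (C z))\<^sup>2 \<le> (norm z)\<^sup>2" for z
      using norm_blinfun[of C z] mult_right_mono[OF C(3) norm_ge_zero[of z]] by (intro power_mono) auto
    have "(norm (X x))\<^sup>2 = (norm x)\<^sup>2 - 2 * (norm (C x))\<^sup>2 + (norm (C (C x)))\<^sup>2"
      unfolding X_def
      by (simp add: op_apply norm_diff_square norm_square[of "C x"] selfadjoint_cinner[OF C(2)])
    also have "\<dots> \<le> (norm x)\<^sup>2"
      using contract[of "C x"] zero_le_power2[of "norm (C x)"] by linarith
    finally show "norm (X x) \<le> 1 * norm x"
      by (simp add: power2_le_iff_abs_le)
  qed simp
  from square_root_of_id_minus_contraction[OF X this] obtain Y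
    where Y: "Y \<in> V" "selfadjoint Y" "norm Y \<le> 1"
      and sq: "(id_blinfun - Y) o\<^sub>L (id_blinfun - Y) = C o\<^sub>L C"
    unfolding X_def by (metis diff_diff_eq2 add_diff_cancel_left')
  define H where "H = id_blinfun - Y"
  have H: "H \<in> V" "H o\<^sub>L H = C o\<^sub>L C"
    unfolding H_def using Y sq by (simp_all add: diff_closed id_closed)
  have H_nonneg: "0 \<le> Re (cinner x (H x))" for x
  proof -
    have "Re (cinner x (Y x)) \<le> norm x * norm (Y x)"
      using cinner_Cauchy_Schwarz[of x "Y x"] complex_Re_le_cmod[of "cinner x (Y x)"] by linarith
    also have "\<dots> \<le> norm x * norm x"
      using norm_blinfun[of Y x] mult_right_mono[OF Y(3) norm_ge_zero[of x]]
      by (intro mult_left_mono) auto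
    finally show ?thesis
      unfolding H_def by (simp add: op_apply cinner_linear cinner_self power2_eq_square)
  qed
  obtain Q where Q: "Q \<in> projections V" "\<And>x. (H - C) x = 0 \<longleftrightarrow> Q x = x"
    using kernel_projection[OF diff_closed[OF H(1) C(1)]] by blast
  have "Q \<in> V"
    using Q(1) unfolding projections_def by simp
  have "(H - C) o\<^sub>L (H + C) = 0"
    using H C commute[of H C] by (simp add: compose_distrib)
  then have "(H - C) ((H + C) x) = 0" for x
    by (metis blinfun_apply_blinfun_compose zero_blinfun.rep_eq)
  then have "Q ((H + C) x) = (H + C) x" for x
    using Q(2) by blast
  then have HC: "(H + C) (Q x) = (H + C) x" for x
    using commute[OF \<open>Q \<in> V\<close> add_closed[OF H(1) C(1)]] by (metis blinfun_apply_blinfun_compose)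
  show ?thesis
  proof (rule that[OF Q(1)])
    fix x
    assume "Q x = x"
    then have "C x = H x"
      using Q(2)[of x] by (simp add: op_apply)
    then show "0 \<le> Re (cinner x (B x))"
      using H_nonneg[of x] k by (simp add: BC)
  next
    fix x
    assume "Q x = 0"
    then have "C x = - H x"
      using HC[of x] by (simp add: op_apply eq_neg_iff_add_eq_0 add.commute)
    then show "Re (cinner x (B x)) \<le> 0"
      using H_nonneg[of x] k by (simp add: BC cinner_minus_right mult_nonneg_nonpos)
  qed
qed

section \<open>Characters\<close>

text \<open>The inverse is the Neumann series, whose partial sums belong to \<open>V\<close>.\<close>

lemma id_minus_contraction_invertible:
  assumes X: "X \<in> V" "norm X < 1"
  obtains R where "R \<in> V" "(id_blinfun - X) o\<^sub>L R = id_blinfun"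
proof -
  define P where "P n = ((\<lambda>P. X o\<^sub>L P) ^^ n) id_blinfun" for n
  have P0: "P 0 = id_blinfun" and PS: "P (Suc n) = X o\<^sub>L P n" for n
    by (simp_all add: P_def)
  have P: "P n \<in> V" for n
    by (induction n) (simp_all add: P0 PS id_closed compose_closed X)
  have "norm (P n) \<le> norm X ^ n" for n
  proof (induction n)
    case 0
    show ?case
      by (simp add: P0 norm_blinfun_id_le)
  next
    case (Suc n)
    then show ?case
      using norm_blinfun_compose[of X "P n"] mult_left_mono[OF Suc norm_ge_zero[of X]]
      by (simp add: PS)
  qed
  moreover have "summable (\<lambda>n. norm X ^ n)"
    using X(2) by (intro summable_geometric) simp
  ultimately have sm: "summable P"
    by (rule summable_comparison_test'[rotated])
  define R where "R = suminf P"
  have "(\<Sum>i<n. P i) \<in> V" for n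
    using P diff_closed[OF id_closed id_closed] by (induction n) (simp_all add: add_closed)
  then have "R \<in> V"
    using limit_closed[OF _ summable_LIMSEQ[OF sm]] unfolding R_def by blast
  moreover have "X o\<^sub>L R = R - id_blinfun"
  proof -
    have "X o\<^sub>L R = (\<Sum>n. X o\<^sub>L P n)"
      unfolding R_def
      by (rule bounded_linear.suminf[OF bounded_bilinear.bounded_linear_right
            [OF bounded_bilinear_blinfun_compose] sm])
    also have "\<dots> = R - id_blinfun"
      unfolding R_def PS[symmetric] by (simp add: suminf_split_head[OF sm] P0)
    finally show ?thesis .
  qed
  ultimately show ?thesis
    using that[of R] by (simp add: compose_distrib)
qed

lemma character_add: "l \<in> spectrum V \<Longrightarrow> A \<in> V \<Longrightarrow> B \<in> V \<Longrightarrow> l (A + B) = l A + l B"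
  and character_compose: "l \<in> spectrum V \<Longrightarrow> A \<in> V \<Longrightarrow> B \<in> V \<Longrightarrow> l (A o\<^sub>L B) = l A * l B"
  and character_scale: "l \<in> spectrum V \<Longrightarrow> A \<in> V \<Longrightarrow> l (scale_op c A) = c * l A"
  and character_id: "l \<in> spectrum V \<Longrightarrow> l id_blinfun = 1"
  unfolding spectrum_def by auto

lemma character_scaleR:
  "l \<in> spectrum V \<Longrightarrow> A \<in> V \<Longrightarrow> l (r *\<^sub>R A) = of_real r * l A"
  using character_scale[of l A "of_real r"] by (simp add: scale_op_of_real)

lemma character_minus: "l \<in> spectrum V \<Longrightarrow> A \<in> V \<Longrightarrow> l (- A) = - l A"
  using character_scaleR[of l A "- 1"] by simp

lemma minus_closed: "A \<in> V \<Longrightarrow> - A \<in> V"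
  using scaleR_closed[of A "- 1"] by simp

lemma character_diff:
  assumes "l \<in> spectrum V" "A \<in> V" "B \<in> V"
  shows "l (A - B) = l A - l B"
  using character_add[OF assms(1,2) minus_closed[OF assms(3)]] character_minus[OF assms(1,3)] by simp

text \<open>Otherwise \<open>l X = 1\<close> for some \<open>X\<close> with \<open>norm X < 1\<close>, but \<open>l\<close> does not vanish on the invertible
  element \<open>id_blinfun - X\<close>.\<close>

lemma character_norm_le:
  assumes l: "l \<in> spectrum V" and A: "A \<in> V"
  shows "cmod (l A) \<le> norm A"
proof (rule ccontr)
  assume "\<not> cmod (l A) \<le> norm A"
  then have less: "norm A < cmod (l A)"
    by simp
  then have "l A \<noteq> 0"
    using norm_ge_zero[of A] by auto
  define X where "X = scale_op (1 / l A) A"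
  have "norm X \<le> norm A / cmod (l A)"
    using norm_scale_op[of "1 / l A" A] by (simp add: X_def norm_divide)
  also have "\<dots> < 1"
    using less \<open>l A \<noteq> 0\<close> by simp
  finally have X: "X \<in> V" "norm X < 1"
    unfolding X_def using A by (simp_all add: scale_closed)
  obtain R where R: "R \<in> V" "(id_blinfun - X) o\<^sub>L R = id_blinfun"
    using id_minus_contraction_invertible[OF X] .
  have "l ((id_blinfun - X) o\<^sub>L R) = (1 - l X) * l R"
    using l X R(1) by (simp add: character_compose character_diff diff_closed id_closed character_id)
  moreover have "l X = 1"
    using \<open>l A \<noteq> 0\<close> l A by (simp add: X_def character_scale)
  ultimately show False
    using R(2) l by (simp add: character_id)
qed

text \<open>Arens' argument: \<open>cmod (l (A + i t))\<^sup>2 \<le> (norm A)\<^sup>2 + t\<^sup>2\<close> for all real \<open>t\<close>, which bounds a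
  nonconstant linear function of \<open>t\<close> unless the imaginary part of \<open>l A\<close> vanishes.\<close>

lemma character_selfadjoint:
  assumes l: "l \<in> spectrum V" and A: "A \<in> V" "selfadjoint A"
  shows "Im (l A) = 0"
proof (rule ccontr)
  define b where "b = Im (l A)"
  assume "Im (l A) \<noteq> 0"
  then have b: "b \<noteq> 0"
    by (simp add: b_def)
  \<comment> \<open>chosen such that \<open>2 * b * t\<close> exceeds \<open>(norm A)\<^sup>2\<close>\<close>
  define t where "t = ((norm A)\<^sup>2 + 1) / (2 * b)"
  define T where "T = A + scale_op (\<i> * t) id_blinfun"
  have "norm T \<le> sqrt ((norm A)\<^sup>2 + t\<^sup>2)"
  proof (rule norm_blinfun_bound)
    fix x
    have "Im (cinner (A x) x) = 0"
      using selfadjoint_cinner_real[OF A(2), of x]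
      by (simp add: selfadjoint_cinner[OF A(2)] complex_is_Real_iff)
    then have "(norm (T x))\<^sup>2 = (norm (A x))\<^sup>2 + (t * norm x)\<^sup>2"
      unfolding T_def
      by (simp add: op_apply norm_add_square cinner_linear norm_scaleC norm_mult power_mult_distrib)
    also have "\<dots> \<le> (norm A * norm x)\<^sup>2 + (t * norm x)\<^sup>2"
      by (simp add: power_mono norm_blinfun)
    also have "\<dots> = (sqrt ((norm A)\<^sup>2 + t\<^sup>2) * norm x)\<^sup>2"
      by (simp add: power_mult_distrib algebra_simps)
    finally show "norm (T x) \<le> sqrt ((norm A)\<^sup>2 + t\<^sup>2) * norm x"
      by (rule power2_le_imp_le) simp
  qed simp
  moreover have T: "T \<in> V" "l T = l A + \<i> * t"
    unfolding T_def using l A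
    by (simp_all add: add_closed scale_closed id_closed character_add character_scale character_id)
  ultimately have "(cmod (l T))\<^sup>2 \<le> (norm A)\<^sup>2 + t\<^sup>2"
    using character_norm_le[OF l T(1)] by (metis norm_ge_zero order_trans real_sqrt_le_iff
        real_sqrt_abs abs_norm_cancel)
  moreover have "(cmod (l T))\<^sup>2 = (Re (l A))\<^sup>2 + (b + t)\<^sup>2"
    unfolding T(2) by (simp add: cmod_power2 b_def)
  ultimately have "(b + t)\<^sup>2 \<le> (norm A)\<^sup>2 + t\<^sup>2"
    using zero_le_power2[of "Re (l A)"] by linarith
  moreover have "2 * b * t = (norm A)\<^sup>2 + 1"
    using b by (simp add: t_def)
  ultimately show False
    using zero_le_power2[of b] by (simp add: power2_sum)
qed

text \<open>For \<open>0 \<le> C\<close> the operator \<open>norm C - C\<close> has norm at most \<open>norm C\<close>, so \<open>l C\<close> lies in the disc of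
  radius \<open>norm C\<close> around \<open>norm C\<close>.\<close>

lemma character_nonneg:
  assumes l: "l \<in> spectrum V" and C: "C \<in> V" "selfadjoint C"
    and nonneg: "\<And>x. 0 \<le> Re (cinner x (C x))"
  shows "0 \<le> Re (l C)"
proof -
  define T where "T = norm C *\<^sub>R id_blinfun - C"
  have T: "T \<in> V" "selfadjoint T" "l T = of_real (norm C) - l C"
    unfolding T_def using l C selfadjoint_scale[OF selfadjoint_id, of "norm C"]
    by (simp_all add: diff_closed scaleR_closed id_closed selfadjoint_diff
        selfadjoint_scaleR selfadjoint_id character_diff character_scaleR character_id)
  have "norm T \<le> norm C"
  proof (rule norm_blinfun_bound)
    show "norm (T x) \<le> norm C * norm x" for x
    proof (rule norm_le_quadratic_form[OF T(2)])
      fix x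
      have "Re (cinner x (C x)) \<le> norm x * norm (C x)"
        using cinner_Cauchy_Schwarz[of x "C x"] complex_Re_le_cmod[of "cinner x (C x)"] by linarith
      also have "\<dots> \<le> norm x * (norm C * norm x)"
        by (intro mult_left_mono norm_blinfun) simp
      finally have "Re (cinner x (C x)) \<le> norm C * (norm x)\<^sup>2"
        by (simp add: power2_eq_square ac_simps)
      moreover have "Re (cinner x (T x)) = norm C * (norm x)\<^sup>2 - Re (cinner x (C x))"
        unfolding T_def by (simp add: op_apply scaleR_blinfun.rep_eq cinner_linear norm_square)
      ultimately show "\<bar>Re (cinner x (T x))\<bar> \<le> norm C * (norm x)\<^sup>2"
        using nonneg[of x] by simp
    qed
  qed simp
  then have "cmod (of_real (norm C) - l C) \<le> norm C"
    using character_norm_le[OF l T(1)] T(3) by simp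
  then show ?thesis
    using complex_Re_le_cmod[of "of_real (norm C) - l C"] by simp
qed

lemma projectionsD:
  assumes "P \<in> projections V"
  shows "P \<in> V" "P o\<^sub>L P = P" "P (P x) = P x"
  using assms blinfun_apply_blinfun_compose[of P P x] unfolding projections_def by simp_all

lemma character_projection:
  assumes "l \<in> spectrum V" "P \<in> projections V"
  shows "l P = 0 \<or> l P = 1"
proof -
  have "l P * l P = l P"
    using character_compose[OF assms(1), of P P] projectionsD[OF assms(2)] by simp
  then show ?thesis
    by simp
qed

lemma id_projection: "id_blinfun \<in> projections V"
  unfolding projections_def by (simp add: id_closed)

lemma compose_projection:
  assumes "P \<in> projections V" "Q \<in> projections V"
  shows "P o\<^sub>L Q \<in> projections V"
proof -
  note PQ = projectionsD[OF assms(1)] projectionsD[OF assms(2)]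
  have "P (Q (P (Q x))) = P (Q x)" for x
    using commute[OF PQ(1,4)] PQ(3,6) by (metis blinfun_apply_blinfun_compose)
  then have "(P o\<^sub>L Q) o\<^sub>L (P o\<^sub>L Q) = P o\<^sub>L Q"
    by (intro blinfun_eqI) simp
  moreover have "selfadjoint (P o\<^sub>L Q)"
    using assms PQ by (intro selfadjoint_compose projections_selfadjoint commute)
  ultimately show ?thesis
    using PQ unfolding projections_def selfadjoint_def by (simp add: compose_closed)
qed

lemma complement_projection:
  assumes "P \<in> projections V"
  shows "id_blinfun - P \<in> projections V"
  using assms projectionsD[OF assms] selfadjoint_diff[OF selfadjoint_id projections_selfadjoint[OF assms]]
  unfolding projections_def selfadjoint_def
  by (simp add: diff_closed id_closed compose_distrib)

lemma projection_compression:
  assumes B: "B \<in> V" and P: "P \<in> projections V"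
  shows "cinner x ((P o\<^sub>L B) x) = cinner (P x) (B (P x))"
proof -
  have "P (B x) = P (B (P x))"
    using commute[OF projectionsD(1)[OF P] B] projectionsD(2)[OF P]
    by (metis blinfun_apply_blinfun_compose)
  then show ?thesis
    by (simp add: selfadjoint_cinner[OF projections_selfadjoint[OF P]])
qed

text \<open>If \<open>B\<close> is nonnegative on the range of \<open>P\<close>, then \<open>P o\<^sub>L B\<close> is nonnegative.\<close>

lemma character_nonneg_on_projection:
  assumes B: "B \<in> V" "selfadjoint B" and P: "P \<in> projections V"
    and pos: "\<And>x. P x = x \<Longrightarrow> 0 \<le> Re (cinner x (B x))"
    and l: "l \<in> spectrum V" "l P = 1"
  shows "0 \<le> Re (l B)"
proof -
  note PV = projectionsD(1)[OF P]
  have "0 \<le> Re (l (P o\<^sub>L B))"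
  proof (rule character_nonneg[OF l(1)])
    show "P o\<^sub>L B \<in> V"
      using PV B by (simp add: compose_closed)
    show "selfadjoint (P o\<^sub>L B)"
      by (rule selfadjoint_compose[OF projections_selfadjoint[OF P] B(2) commute[OF PV B(1)]])
    fix x
    show "0 \<le> Re (cinner x ((P o\<^sub>L B) x))"
      unfolding projection_compression[OF B(1) P] using pos projectionsD(3)[OF P] by simp
  qed
  then show ?thesis
    using l B PV by (simp add: character_compose)
qed

lemma character_spectral_cut:
  assumes B: "B \<in> V" "selfadjoint B"
  obtains Q where "Q \<in> projections V"
    "\<And>l. l \<in> spectrum V \<Longrightarrow> l Q = 1 \<Longrightarrow> 0 \<le> Re (l B)"
    "\<And>l. l \<in> spectrum V \<Longrightarrow> l Q = 0 \<Longrightarrow> Re (l B) \<le> 0"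
proof -
  obtain Q where Q: "Q \<in> projections V" "\<And>x. Q x = x \<Longrightarrow> 0 \<le> Re (cinner x (B x))"
    "\<And>x. Q x = 0 \<Longrightarrow> Re (cinner x (B x)) \<le> 0"
    using spectral_cut[OF B] by blast
  have B': "- B \<in> V" "selfadjoint (- B)"
    using B minus_closed selfadjoint_scaleR[of B "- 1"] by simp_all
  have P: "id_blinfun - Q \<in> projections V"
    by (rule complement_projection[OF Q(1)])
  show ?thesis
  proof (rule that[OF Q(1)])
    fix l
    assume l: "l \<in> spectrum V"
    show "0 \<le> Re (l B)" if "l Q = 1"
      using character_nonneg_on_projection[OF B Q(1) Q(2) l that] by blast
    assume "l Q = 0"
    then have "l (id_blinfun - Q) = 1"
      using l projectionsD(1)[OF Q(1)] by (simp add: character_diff id_closed character_id)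
    then have "0 \<le> Re (l (- B))"
      using Q(3) by (intro character_nonneg_on_projection[OF B' P _ l])
        (simp add: op_apply cinner_linear)
    then show "Re (l B) \<le> 0"
      using l B by (simp add: character_minus)
  qed
qed

text \<open>The cut of \<open>e\<^sup>2 - (A - a)\<^sup>2\<close> is the spectral projection of \<open>A\<close> for the interval of radius \<open>e\<close>
  around \<open>a\<close>.\<close>

lemma projection_neighbourhood_selfadjoint:
  assumes A: "A \<in> V" "selfadjoint A" and l: "l \<in> spectrum V" and e: "0 < e"
  obtains Q where "Q \<in> projections V" "l Q = 1"
    "\<And>k. k \<in> spectrum V \<Longrightarrow> k Q = 1 \<Longrightarrow> cmod (k A - l A) \<le> e"
proof -
  define a where "a = Re (l A)"
  define T where "T = A - a *\<^sub>R id_blinfun"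
  have T: "T \<in> V" "selfadjoint T"
    unfolding T_def using A
    by (simp_all add: diff_closed scaleR_closed id_closed selfadjoint_diff
        selfadjoint_scaleR selfadjoint_id)
  define B where "B = e\<^sup>2 *\<^sub>R id_blinfun - (T o\<^sub>L T)"
  have B: "B \<in> V" "selfadjoint B"
    unfolding B_def using T
    by (simp_all add: diff_closed scaleR_closed id_closed compose_closed selfadjoint_diff
        selfadjoint_scaleR selfadjoint_id selfadjoint_compose)
  have diff: "k A - l A = of_real (Re (k A) - a)" if "k \<in> spectrum V" for k
    using character_selfadjoint[OF that A] character_selfadjoint[OF l A]
    by (simp add: complex_eq_iff a_def)
  have kB: "Re (k B) = e\<^sup>2 - (Re (k A) - a)\<^sup>2" if k: "k \<in> spectrum V" for k
  proof -
    have "k A = of_real (Re (k A))"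
      using character_selfadjoint[OF k A] by (simp add: complex_eq_iff)
    then have "k T = of_real (Re (k A) - a)"
      unfolding T_def using k A
      by (simp add: character_diff character_scaleR character_id id_closed scaleR_closed)
    then have "k B = of_real (e\<^sup>2) - of_real (Re (k A) - a) * of_real (Re (k A) - a)"
      unfolding B_def using k T
      by (simp add: character_diff character_scaleR character_id id_closed scaleR_closed
          character_compose compose_closed)
    also have "\<dots> = of_real (e\<^sup>2 - (Re (k A) - a)\<^sup>2)"
      by (simp add: power2_eq_square)
    finally show ?thesis
      by (simp only: Re_complex_of_real)
  qed
  obtain Q where Q: "Q \<in> projections V"
    "\<And>l. l \<in> spectrum V \<Longrightarrow> l Q = 1 \<Longrightarrow> 0 \<le> Re (l B)"
    "\<And>l. l \<in> spectrum V \<Longrightarrow> l Q = 0 \<Longrightarrow> Re (l B) \<le> 0"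
    using character_spectral_cut[OF B] by blast
  show ?thesis
  proof (rule that[OF Q(1)])
    have "\<not> Re (l B) \<le> 0"
      using kB[OF l] e by (simp add: a_def)
    then show "l Q = 1"
      using Q(3)[OF l] character_projection[OF l Q(1)] by blast
    fix k
    assume k: "k \<in> spectrum V" "k Q = 1"
    then have "(Re (k A) - a)\<^sup>2 \<le> e\<^sup>2"
      using Q(2)[OF k] kB[OF k(1)] by simp
    then have "\<bar>Re (k A) - a\<bar> \<le> e"
      using e by (simp add: power2_le_iff_abs_le)
    then show "cmod (k A - l A) \<le> e"
      unfolding diff[OF k(1)] by (simp only: norm_of_real)
  qed
qed

lemma cartesian_decomposition:
  assumes A: "A \<in> V"
  obtains R S where "R \<in> V" "selfadjoint R" "S \<in> V" "selfadjoint S" "A = R + scale_op \<i> S"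
proof -
  define R where "R = scale_op (1/2) (A + adj A)"
  define S where "S = scale_op (- \<i> / 2) (A - adj A)"
  note Ab = bounded[OF A] adj_in_bounded_ops[OF bounded[OF A]]
  have "R \<in> V" "S \<in> V"
    unfolding R_def S_def using A by (simp_all add: scale_closed add_closed diff_closed adj_closed)
  moreover have "adj R = R"
    unfolding R_def using Ab
    by (simp add: adj_scale add_in_bounded_ops adj_add adj_adj add.commute)
  moreover have "adj S = S"
  proof -
    have "adj S = scale_op (\<i> / 2) (adj A - A)"
      unfolding S_def using Ab by (simp add: adj_scale diff_in_bounded_ops adj_diff adj_adj)
    also have "\<dots> = S"
      unfolding S_def
      by (rule blinfun_eqI) (simp add: op_apply scaleC_diff_right scaleC_minus_left)
    finally show ?thesis .
  qed
  moreover have "A = R + scale_op \<i> S"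
  proof (rule blinfun_eqI)
    fix x
    have "(R + scale_op \<i> S) x = (1/2) *\<^sub>C (A x + adj A x) + (1/2) *\<^sub>C (A x - adj A x)"
      unfolding R_def S_def by (simp add: op_apply scaleC_scaleC)
    also have "\<dots> = (1/2 + 1/2) *\<^sub>C A x"
      unfolding scaleC_add_right scaleC_diff_right scaleC_add_left by simp
    finally show "A x = (R + scale_op \<i> S) x"
      by simp
  qed
  ultimately show ?thesis
    using that bounded unfolding selfadjoint_def by blast
qed

lemma projection_neighbourhood:
  assumes A: "A \<in> V" and l: "l \<in> spectrum V" and e: "0 < e"
  obtains Q where "Q \<in> projections V" "l Q = 1"
    "\<And>k. k \<in> spectrum V \<Longrightarrow> k Q = 1 \<Longrightarrow> cmod (k A - l A) < e"
proof -
  obtain R S where RS: "R \<in> V" "selfadjoint R" "S \<in> V" "selfadjoint S" "A = R + scale_op \<i> S"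
    using cartesian_decomposition[OF A] .
  have e3: "0 < e / 3"
    using e by simp
  obtain P where P: "P \<in> projections V" "l P = 1"
    "\<And>k. k \<in> spectrum V \<Longrightarrow> k P = 1 \<Longrightarrow> cmod (k R - l R) \<le> e / 3"
    using projection_neighbourhood_selfadjoint[OF RS(1,2) l e3] by blast
  obtain Q where Q: "Q \<in> projections V" "l Q = 1"
    "\<And>k. k \<in> spectrum V \<Longrightarrow> k Q = 1 \<Longrightarrow> cmod (k S - l S) \<le> e / 3"
    using projection_neighbourhood_selfadjoint[OF RS(3,4) l e3] by blast
  note PQV = projectionsD(1)[OF P(1)] projectionsD(1)[OF Q(1)]
  show ?thesis
  proof (rule that)
    show "P o\<^sub>L Q \<in> projections V"
      by (rule compose_projection[OF P(1) Q(1)])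
    show "l (P o\<^sub>L Q) = 1"
      using l PQV P Q by (simp add: character_compose)
    fix k
    assume k: "k \<in> spectrum V" "k (P o\<^sub>L Q) = 1"
    then have "k P * k Q = 1"
      using PQV by (simp add: character_compose)
    then have "k P = 1" "k Q = 1"
      using character_projection[OF k(1) P(1)] character_projection[OF k(1) Q(1)] by auto
    then have bounds: "cmod (k R - l R) \<le> e / 3" "cmod (k S - l S) \<le> e / 3"
      using P(3) Q(3) k(1) by blast+
    have "k A - l A = (k R - l R) + \<i> * (k S - l S)"
      unfolding RS(5) using k l RS
      by (simp add: character_add character_scale scale_closed algebra_simps)
    then have "cmod (k A - l A) \<le> cmod (k R - l R) + cmod (k S - l S)"
      using norm_triangle_ineq[of "k R - l R" "\<i> * (k S - l S)"] by (simp add: norm_mult)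
    then show "cmod (k A - l A) < e"
      using bounds e by linarith
  qed
qed

section \<open>Clopen subsets of the spectrum\<close>

lemma alpha_compose:
  assumes "P \<in> projections V" "Q \<in> projections V"
  shows "alpha V (P o\<^sub>L Q) = alpha V P \<inter> alpha V Q"
proof -
  have "l (P o\<^sub>L Q) = 1 \<longleftrightarrow> l P = 1 \<and> l Q = 1" if "l \<in> spectrum V" for l
    unfolding character_compose[OF that projectionsD(1)[OF assms(1)] projectionsD(1)[OF assms(2)]]
    using character_projection[OF that assms(1)] character_projection[OF that assms(2)] by auto
  then show ?thesis
    unfolding alpha_def by blast
qed

lemma alpha_complement:
  assumes "P \<in> projections V"
  shows "alpha V (id_blinfun - P) = spectrum V - alpha V P"
proof -
  have "l (id_blinfun - P) = 1 \<longleftrightarrow> l P \<noteq> 1" if "l \<in> spectrum V" for l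
    unfolding character_diff[OF that id_closed projectionsD(1)[OF assms]] character_id[OF that]
    using character_projection[OF that assms] by auto
  then show ?thesis
    unfolding alpha_def by blast
qed

lemma alpha_finite_Inter:
  assumes "finite I" "\<And>i. i \<in> I \<Longrightarrow> Q i \<in> projections V"
  shows "\<exists>P\<in>projections V. alpha V P = spectrum V \<inter> (\<Inter>i\<in>I. alpha V (Q i))"
  using assms
proof (induction I)
  case empty
  have "alpha V id_blinfun = spectrum V"
    unfolding alpha_def using character_id by blast
  then show ?case
    using id_projection by (intro bexI[of _ id_blinfun]) simp_all
next
  case (insert i I)
  obtain P where P: "P \<in> projections V" "alpha V P = spectrum V \<inter> (\<Inter>i\<in>I. alpha V (Q i))"
    using insert.IH insert.prems by blast
  have Qi: "Q i \<in> projections V"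
    using insert.prems by simp
  have "alpha V (Q i o\<^sub>L P) = spectrum V \<inter> (\<Inter>i\<in>insert i I. alpha V (Q i))"
    unfolding alpha_compose[OF Qi P(1)] P(2) by blast
  then show ?case
    using compose_projection[OF Qi P(1)] by blast
qed

lemma alpha_finite_Union:
  assumes "finite I" "I \<subseteq> projections V"
  shows "\<exists>P\<in>projections V. alpha V P = (\<Union>Q\<in>I. alpha V Q)"
proof -
  obtain P where P: "P \<in> projections V"
    "alpha V P = spectrum V \<inter> (\<Inter>Q\<in>I. alpha V (id_blinfun - Q))"
    using alpha_finite_Inter[OF assms(1), of "\<lambda>Q. id_blinfun - Q"] assms(2) complement_projection
    by blast
  have "alpha V (id_blinfun - P) = (\<Union>Q\<in>I. alpha V Q)"
  proof -
    have "alpha V (id_blinfun - Q) = spectrum V - alpha V Q" if "Q \<in> I" for Q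
      using that assms(2) alpha_complement by blast
    moreover have "alpha V Q \<subseteq> spectrum V" for Q
      unfolding alpha_def by blast
    ultimately show ?thesis
      unfolding alpha_complement[OF P(1)] P(2) by auto
  qed
  then show ?thesis
    using complement_projection[OF P(1)] by blast
qed

lemma spectrum_subset_topspace: "spectrum V \<subseteq> topspace (product_topology (\<lambda>_. euclidean) V)"
  unfolding spectrum_def by (auto simp: PiE_def)

lemma topspace_spectrum: "topspace (spectrum_topology V) = spectrum V"
  using spectrum_subset_topspace unfolding spectrum_topology_def by auto

lemma openin_alpha:
  assumes P: "P \<in> projections V"
  shows "openin (spectrum_topology V) (alpha V P)"
proof -
  have "continuous_map (spectrum_topology V) euclidean (\<lambda>l. l P)"
    unfolding spectrum_topology_def
    by (intro continuous_map_from_subtopology continuous_map_product_projection projectionsD(1)[OF P])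
  \<comment> \<open>of the possible values \<open>0\<close> and \<open>1\<close> the open disc contains only \<open>1\<close>\<close>
  then have "openin (spectrum_topology V) {l \<in> spectrum V. l P \<in> ball 1 1}"
    using openin_continuous_map_preimage[of "spectrum_topology V" euclidean "\<lambda>l. l P" "ball 1 1"]
    by (simp add: topspace_spectrum)
  moreover have "{l \<in> spectrum V. l P \<in> ball 1 1} = alpha V P"
    unfolding alpha_def using character_projection[OF _ P] by force
  ultimately show ?thesis
    by simp
qed

text \<open>A basic open set restricts the values of characters at finitely many operators. By
  \<open>projection_neighbourhood\<close> each restriction is implied by a projection, and the product of these
  projections implies all of them.\<close>

lemma alpha_base:
  assumes S: "openin (spectrum_topology V) S" and l: "l \<in> S"
  obtains P where "P \<in> projections V" "l \<in> alpha V P" "alpha V P \<subseteq> S"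
proof -
  have ls: "l \<in> spectrum V"
    using openin_subset[OF S] l topspace_spectrum by blast
  obtain T where T: "openin (product_topology (\<lambda>_. euclidean) V) T" "S = T \<inter> spectrum V"
    using S unfolding spectrum_topology_def openin_subtopology by blast
  then obtain X where X: "finite {A \<in> V. X A \<noteq> UNIV}" "\<And>A. A \<in> V \<Longrightarrow> open (X A)"
    "l \<in> Pi\<^sub>E V X" "Pi\<^sub>E V X \<subseteq> T"
    using l unfolding openin_product_topology_alt by auto
  define I where "I = {A \<in> V. X A \<noteq> UNIV}"
  have "\<exists>Q. Q \<in> projections V \<and> l Q = 1 \<and> (\<forall>k\<in>spectrum V. k Q = 1 \<longrightarrow> k A \<in> X A)"
    if A: "A \<in> I" for A
  proof -
    have AV: "A \<in> V" and "l A \<in> X A"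
      using A X(3) unfolding I_def by auto
    then obtain e where e: "0 < e" "ball (l A) e \<subseteq> X A"
      using X(2) open_contains_ball by blast
    obtain Q where "Q \<in> projections V" "l Q = 1"
      "\<And>k. k \<in> spectrum V \<Longrightarrow> k Q = 1 \<Longrightarrow> cmod (k A - l A) < e"
      using projection_neighbourhood[OF AV ls e(1)] by blast
    moreover from this have "k A \<in> X A" if "k \<in> spectrum V" "k Q = 1" for k
      using that e(2) by (auto simp: subset_iff dist_norm norm_minus_commute)
    ultimately show ?thesis
      by blast
  qed
  then obtain Q where Q: "\<And>A. A \<in> I \<Longrightarrow> Q A \<in> projections V" "\<And>A. A \<in> I \<Longrightarrow> l (Q A) = 1"
    "\<And>A k. A \<in> I \<Longrightarrow> k \<in> spectrum V \<Longrightarrow> k (Q A) = 1 \<Longrightarrow> k A \<in> X A"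
    by metis
  obtain P where P: "P \<in> projections V" "alpha V P = spectrum V \<inter> (\<Inter>A\<in>I. alpha V (Q A))"
    using alpha_finite_Inter[of I Q] X(1) Q(1) unfolding I_def by blast
  show ?thesis
  proof (rule that[OF P(1)])
    show "l \<in> alpha V P"
      unfolding P(2) using ls Q(2) by (auto simp: alpha_def)
    show "alpha V P \<subseteq> S"
    proof
      fix k
      assume "k \<in> alpha V P"
      then have k: "k \<in> spectrum V" "\<And>A. A \<in> I \<Longrightarrow> k (Q A) = 1"
        unfolding P(2) by (auto simp: alpha_def)
      have "k A \<in> X A" if "A \<in> V" for A
        using Q(3)[OF _ k(1) k(2), of A] that unfolding I_def by blast
      moreover have "k \<in> extensional V"
        using k(1) unfolding spectrum_def by simp
      ultimately have "k \<in> Pi\<^sub>E V X"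
        by (simp add: PiE_def)
      with X(4) k(1) show "k \<in> S"
        unfolding T(2) by blast
    qed
  qed
qed

text \<open>Since \<open>cmod (l A) \<le> norm A\<close>, the spectrum is a closed subset of a product of discs.\<close>

lemma compact_spectrum: "compact_space (spectrum_topology V)"
proof -
  define T where "T = product_topology (\<lambda>_::'a op. euclidean :: complex topology) V"
  have ev: "continuous_map T euclidean (\<lambda>l. l A)" if "A \<in> V" for A
    unfolding T_def by (rule continuous_map_product_projection[OF that])
  have topT: "topspace T = extensional V"
    by (auto simp: T_def PiE_def)
  have closed_eq: "closedin T {l \<in> extensional V. f l = g l}"
    if "continuous_map T euclidean f" "continuous_map T euclidean g" for f g :: "_ \<Rightarrow> complex"
    using closedin_continuous_maps_eq[OF Hausdorff_space_euclidean that] by (simp add: topT)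
  have mult: "continuous_map T euclidean (\<lambda>l. f l * g l)"
    if "continuous_map T euclidean f" "continuous_map T euclidean g" for f g :: "_ \<Rightarrow> complex"
    using that by (simp add: continuous_map_atin tendsto_mult)
  have ne: "V \<noteq> {}"
    using id_closed by blast
  have "spectrum V =
      (\<Inter>A\<in>V. \<Inter>B\<in>V. {l \<in> extensional V. l (A + B) = l A + l B} \<inter>
        {l \<in> extensional V. l (A o\<^sub>L B) = l A * l B}) \<inter>
      (\<Inter>A\<in>V. \<Inter>c. {l \<in> extensional V. l (scale_op c A) = c * l A}) \<inter>
      {l \<in> extensional V. l id_blinfun = 1}"
    unfolding spectrum_def by auto
  also have "closedin T \<dots>"
    using ne
    by (intro closedin_Int closedin_INT closed_eq ev mult continuous_map_add continuous_map_const[THEN iffD2])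
      (auto simp: add_closed compose_closed scale_closed id_closed)
  finally have "closedin T (spectrum V)" .
  moreover have "spectrum V \<subseteq> Pi\<^sub>E V (\<lambda>A. cball 0 (norm A))"
    using character_norm_le by (auto simp: PiE_def spectrum_def)
  moreover have "compactin T (Pi\<^sub>E V (\<lambda>A. cball 0 (norm A)))"
    unfolding T_def compactin_PiE by simp
  ultimately have "compactin T (spectrum V)"
    using closed_compactin by blast
  then show ?thesis
    unfolding spectrum_topology_def T_def by (rule compact_space_subtopology)
qed

text \<open>A clopen set is a union of basic sets \<open>alpha V P\<close> and compact, hence a finite union of them.\<close>

lemma alpha_surjective:
  assumes S: "S \<in> clopens V"
  obtains P where "P \<in> projections V" "alpha V P = S"
proof -
  have op: "openin (spectrum_topology V) S" and "compactin (spectrum_topology V) S"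
    using S closedin_compact_space[OF compact_spectrum] unfolding clopens_def by blast+
  define J where "J = {Q \<in> projections V. alpha V Q \<subseteq> S}"
  have "S \<subseteq> \<Union> (alpha V ` J)"
    using alpha_base[OF op] unfolding J_def by blast
  then obtain F where F: "finite F" "F \<subseteq> alpha V ` J" "S \<subseteq> \<Union> F"
    using compactinD[OF \<open>compactin (spectrum_topology V) S\<close>, of "alpha V ` J"] openin_alpha
    unfolding J_def by blast
  then obtain I where I: "I \<subseteq> J" "finite I" "F = alpha V ` I"
    using finite_subset_image by metis
  obtain P where "P \<in> projections V" "alpha V P = (\<Union>Q\<in>I. alpha V Q)"
    using alpha_finite_Union[OF I(2)] I(1) unfolding J_def by blast
  moreover have "(\<Union>Q\<in>I. alpha V Q) = S"
    using I F(3) unfolding J_def by blast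
  ultimately show ?thesis
    using that by simp
qed

section \<open>Existence of characters\<close>

lemma compose_projection_fixes:
  assumes P: "P \<in> projections V" and Q: "Q \<in> projections V" and x: "(P o\<^sub>L Q) x = x"
  shows "P x = x" "Q x = x"
proof -
  have PQ: "P (Q x) = x"
    using x by simp
  then show "P x = x"
    using projectionsD(3)[OF P] by metis
  have "Q (P x) = P (Q x)"
    using commute[OF projectionsD(1)[OF P] projectionsD(1)[OF Q]] by (metis blinfun_apply_blinfun_compose)
  with \<open>P x = x\<close> PQ show "Q x = x"
    by simp
qed

lemma projection_norm_le:
  assumes "P \<in> projections V"
  shows "norm (P x) \<le> norm x"
proof -
  have "norm (P x) * norm (P x) = Re (cinner (P x) (P x))"
    unfolding norm_square[symmetric] by (rule power2_eq_square[symmetric])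
  also have "\<dots> = Re (cinner x (P x))"
    by (simp add: selfadjoint_cinner[OF projections_selfadjoint[OF assms]] projectionsD(3)[OF assms])
  also have "\<dots> \<le> norm x * norm (P x)"
    using cinner_Cauchy_Schwarz[of x "P x"] complex_Re_le_cmod[of "cinner x (P x)"] by linarith
  finally show ?thesis
    by (cases "P x = 0") simp_all
qed

text \<open>The operator \<open>P o\<^sub>L A\<close> is self-adjoint and agrees with \<open>A\<close> on the range of \<open>P\<close>, while its
  quadratic form is bounded on the whole space.\<close>

lemma quadratic_form_bound_on_projection:
  assumes A: "A \<in> V" "selfadjoint A" and P: "P \<in> projections V" and e: "0 \<le> e"
    and bound: "\<And>x. P x = x \<Longrightarrow> \<bar>Re (cinner x (A x))\<bar> \<le> e * (norm x)\<^sup>2"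
    and x: "P x = x"
  shows "norm (A x) \<le> e * norm x"
proof -
  have "norm ((P o\<^sub>L A) x) \<le> e * norm x"
  proof (rule norm_le_quadratic_form)
    show "selfadjoint (P o\<^sub>L A)"
      by (rule selfadjoint_compose[OF projections_selfadjoint[OF P] A(2)
            commute[OF projectionsD(1)[OF P] A(1)]])
    fix y
    have "\<bar>Re (cinner y ((P o\<^sub>L A) y))\<bar> \<le> e * (norm (P y))\<^sup>2"
      unfolding projection_compression[OF A(1) P] using bound projectionsD(3)[OF P] by simp
    also have "\<dots> \<le> e * (norm y)\<^sup>2"
      by (intro mult_left_mono power_mono projection_norm_le P e) simp
    finally show "\<bar>Re (cinner y ((P o\<^sub>L A) y))\<bar> \<le> e * (norm y)\<^sup>2" .
  qed
  moreover have "(P o\<^sub>L A) x = A x"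
    unfolding commute[OF projectionsD(1)[OF P] A(1)] by (simp add: x)
  ultimately show ?thesis
    by simp
qed

text \<open>Maximal multiplicatively closed sets of nonzero projections are ultrafilters. If neither \<open>Q\<close>
  nor its complement belonged to such a set, each would annihilate a member by maximality, and
  the product of these two members would vanish.\<close>

lemma projection_ultrafilter_exists:
  assumes P: "P \<in> projections V" "P \<noteq> 0"
  obtains F where "F \<subseteq> projections V" "P \<in> F" "id_blinfun \<in> F" "0 \<notin> F"
    "\<And>Q R. Q \<in> F \<Longrightarrow> R \<in> F \<Longrightarrow> Q o\<^sub>L R \<in> F"
    "\<And>Q. Q \<in> projections V \<Longrightarrow> Q \<in> F \<or> id_blinfun - Q \<in> F"
proof -
  define \<F> where "\<F> = {F. F \<subseteq> projections V \<and> P \<in> F \<and> id_blinfun \<in> F \<and> 0 \<notin> F \<and>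
    (\<forall>Q\<in>F. \<forall>R\<in>F. Q o\<^sub>L R \<in> F)}"
  have "id_blinfun \<noteq> (0 :: 'a op)"
    using P(2) id_compose(1)[of P] by force
  then have "{P, id_blinfun} \<in> \<F>"
    using P id_projection projectionsD(2)[OF P(1)] unfolding \<F>_def by auto
  moreover have "\<Union> \<C> \<in> \<F>" if "\<C> \<noteq> {}" and chain: "subset.chain \<F> \<C>" for \<C>
  proof -
    have sub: "\<C> \<subseteq> \<F>"
      using chain unfolding subset.chain_def by blast
    have "Q o\<^sub>L R \<in> \<Union> \<C>" if "Q \<in> \<Union> \<C>" "R \<in> \<Union> \<C>" for Q R
    proof -
      from that obtain F G where FG: "F \<in> \<C>" "Q \<in> F" "G \<in> \<C>" "R \<in> G"
        by blast
      then have "F \<subseteq> G \<or> G \<subseteq> F"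
        using chain unfolding subset_chain_def by blast
      then obtain H where H: "H \<in> \<C>" "Q \<in> H" "R \<in> H"
        using FG by blast
      then have "H \<in> \<F>"
        using sub by blast
      then show ?thesis
        using H unfolding \<F>_def by blast
    qed
    then show ?thesis
      using sub \<open>\<C> \<noteq> {}\<close> unfolding \<F>_def by blast
  qed
  ultimately obtain F where F: "F \<in> \<F>" "\<And>G. G \<in> \<F> \<Longrightarrow> F \<subseteq> G \<Longrightarrow> G = F"
    using subset_Zorn_nonempty[of \<F>] by blast
  have FP: "F \<subseteq> projections V" "P \<in> F" "id_blinfun \<in> F" "0 \<notin> F"
    and FC: "\<And>Q R. Q \<in> F \<Longrightarrow> R \<in> F \<Longrightarrow> Q o\<^sub>L R \<in> F"
    using F(1) unfolding \<F>_def by blast+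
  have FV: "Q \<in> V" if "Q \<in> F" for Q
    using that FP(1) projectionsD(1) by blast
  have annihilated: "\<exists>R\<in>F. Q o\<^sub>L R = 0" if Q: "Q \<in> projections V" "Q \<notin> F" for Q
  proof (rule ccontr)
    assume *: "\<not> (\<exists>R\<in>F. Q o\<^sub>L R = 0)"
    note QV = projectionsD(1)[OF Q(1)]
    \<comment> \<open>the multiplicatively closed set generated by \<open>F\<close> and \<open>Q\<close>\<close>
    define G where "G = F \<union> (\<lambda>R. Q o\<^sub>L R) ` F"
    have c1: "R o\<^sub>L (Q o\<^sub>L R') = Q o\<^sub>L (R o\<^sub>L R')" if "R \<in> F" for R R'
      using commute[OF FV[OF that] QV] by (metis blinfun_compose_assoc)
    have c2: "(Q o\<^sub>L R) o\<^sub>L R' = Q o\<^sub>L (R o\<^sub>L R')" for R R'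
      by (rule blinfun_compose_assoc)
    have c3: "Q o\<^sub>L (Q o\<^sub>L R) = Q o\<^sub>L R" for R
      using projectionsD(2)[OF Q(1)] by (metis blinfun_compose_assoc)
    have "\<forall>S\<in>G. \<forall>T\<in>G. S o\<^sub>L T \<in> G"
      unfolding G_def by (auto simp: c1 c2 c3 FC)
    moreover have "G \<subseteq> projections V"
      unfolding G_def using FP(1) compose_projection[OF Q(1)] by blast
    moreover have "0 \<notin> G"
      using * FP(4) unfolding G_def by force
    ultimately have "G \<in> \<F>"
      using FP unfolding \<F>_def G_def by blast
    then have "G = F"
      using F(2) unfolding G_def by blast
    moreover have "Q \<in> G"
      unfolding G_def using FP(3) id_compose(2)[of Q] by (metis UnCI imageI)
    ultimately show False
      using Q(2) by blast
  qed
  have "Q \<in> F \<or> id_blinfun - Q \<in> F" if Q: "Q \<in> projections V" for Q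
  proof (rule ccontr)
    assume "\<not> (Q \<in> F \<or> id_blinfun - Q \<in> F)"
    then obtain R R' where R: "R \<in> F" "Q o\<^sub>L R = 0" "R' \<in> F" "(id_blinfun - Q) o\<^sub>L R' = 0"
      using annihilated[OF Q] annihilated[OF complement_projection[OF Q]] by blast
    have "R' = Q o\<^sub>L R'"
      using R(4) by (simp add: compose_distrib)
    then have "R' o\<^sub>L R = Q o\<^sub>L (R' o\<^sub>L R)"
      by (metis blinfun_compose_assoc)
    also have "\<dots> = (Q o\<^sub>L R) o\<^sub>L R'"
      using commute[OF FV[OF R(3)] FV[OF R(1)]] by (simp add: blinfun_compose_assoc)
    also have "\<dots> = 0"
      unfolding R(2) by simp
    finally show False
      using FC[OF R(3,1)] FP(4) by simp
  qed
  then show ?thesis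
    using that FP FC by blast
qed

text \<open>The character sends \<open>A\<close> to its limit along an ultrafilter of projections. For self-adjoint
  \<open>A\<close> the limit is the supremum of the lower bounds of \<open>A\<close> on members of the ultrafilter; the
  spectral cut of \<open>A\<close> just above the supremum makes it an upper bound as well.\<close>

lemma character_at_projection_exists:
  assumes P: "P \<in> projections V" "P \<noteq> 0"
  obtains l where "l \<in> spectrum V" "l P = 1"
proof -
  obtain F where FP: "F \<subseteq> projections V" "P \<in> F" "id_blinfun \<in> F" "0 \<notin> F"
    and FC: "\<And>Q R. Q \<in> F \<Longrightarrow> R \<in> F \<Longrightarrow> Q o\<^sub>L R \<in> F"
    and ultra: "\<And>Q. Q \<in> projections V \<Longrightarrow> Q \<in> F \<or> id_blinfun - Q \<in> F"
    using projection_ultrafilter_exists[OF P] by blast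
  have F_proj: "Q \<in> projections V" if "Q \<in> F" for Q
    using that FP(1) by blast
  have F_common: "\<exists>S\<in>F. \<forall>x. S x = x \<longrightarrow> Q x = x \<and> R x = x" if "Q \<in> F" "R \<in> F" for Q R
    using FC[OF that] compose_projection_fixes[OF F_proj[OF that(1)] F_proj[OF that(2)]] by blast
  have F_nonzero: "\<exists>x. x \<noteq> 0 \<and> Q x = x" if Q: "Q \<in> F" for Q
  proof -
    have "Q \<noteq> 0"
      using Q FP(4) by blast
    then obtain y where "Q y \<noteq> 0"
      using blinfun_eqI[of Q 0] by auto
    then show ?thesis
      using projectionsD(3)[OF F_proj[OF Q]] by blast
  qed
  \<comment> \<open>\<open>A\<close> tends to \<open>a\<close> along \<open>F\<close>; the estimates are restricted to the ranges of projections.\<close>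
  define conv where "conv A a \<longleftrightarrow>
    (\<forall>e>0. \<exists>Q\<in>F. \<forall>x. Q x = x \<longrightarrow> norm (A x - a *\<^sub>C x) \<le> e * norm x)" for A :: "'a op" and a
  have conv_unique: "a = b" if "conv A a" "conv A b" for A a b
  proof (rule ccontr)
    assume "a \<noteq> b"
    define e where "e = cmod (a - b) / 4"
    have e: "0 < e"
      using \<open>a \<noteq> b\<close> by (simp add: e_def)
    obtain Q R where "Q \<in> F" "\<And>x. Q x = x \<Longrightarrow> norm (A x - a *\<^sub>C x) \<le> e * norm x"
      "R \<in> F" "\<And>x. R x = x \<Longrightarrow> norm (A x - b *\<^sub>C x) \<le> e * norm x"
      using \<open>conv A a\<close> \<open>conv A b\<close> e unfolding conv_def by meson
    moreover from this obtain S where "S \<in> F" "\<forall>x. S x = x \<longrightarrow> Q x = x \<and> R x = x"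
      using F_common by meson
    moreover from this obtain x where "x \<noteq> 0" "S x = x"
      using F_nonzero by blast
    ultimately have x: "x \<noteq> 0" "norm (A x - a *\<^sub>C x) \<le> e * norm x" "norm (A x - b *\<^sub>C x) \<le> e * norm x"
      by blast+
    have "cmod (a - b) * norm x = norm ((A x - b *\<^sub>C x) - (A x - a *\<^sub>C x))"
      using scaleC_add_left[of "a - b" b x] norm_scaleC[of "a - b" x] by simp
    also have "\<dots> \<le> 2 * e * norm x"
      using norm_triangle_ineq4[of "A x - b *\<^sub>C x" "A x - a *\<^sub>C x"] x by simp
    finally show False
      using x(1) \<open>a \<noteq> b\<close> by (simp add: e_def)
  qed
  have conv_add: "conv (A + B) (a + b)" if conv_AB: "conv A a" "conv B b" for A B a b
    unfolding conv_def
  proof (intro allI impI)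
    fix e :: real
    assume "0 < e"
    then have "0 < e / 2"
      by simp
    then obtain Q R where "Q \<in> F" "\<And>x. Q x = x \<Longrightarrow> norm (A x - a *\<^sub>C x) \<le> e / 2 * norm x"
      "R \<in> F" "\<And>x. R x = x \<Longrightarrow> norm (B x - b *\<^sub>C x) \<le> e / 2 * norm x"
      using conv_AB unfolding conv_def by meson
    moreover from this obtain S where S: "S \<in> F" "\<forall>x. S x = x \<longrightarrow> Q x = x \<and> R x = x"
      using F_common by meson
    moreover have "norm ((A + B) x - (a + b) *\<^sub>C x)
        \<le> norm (A x - a *\<^sub>C x) + norm (B x - b *\<^sub>C x)" for x
      using norm_triangle_ineq[of "A x - a *\<^sub>C x" "B x - b *\<^sub>C x"]
      by (simp add: op_apply scaleC_add_left algebra_simps)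
    ultimately have "norm ((A + B) x - (a + b) *\<^sub>C x) \<le> e / 2 * norm x + e / 2 * norm x"
      if "S x = x" for x
      using that by (meson add_mono order_trans)
    with S(1) show "\<exists>Q\<in>F. \<forall>x. Q x = x \<longrightarrow> norm ((A + B) x - (a + b) *\<^sub>C x) \<le> e * norm x"
      by (metis distrib_right field_sum_of_halves)
  qed
  have conv_compose: "conv (A o\<^sub>L B) (a * b)"
    if "A \<in> bounded_ops" and conv_AB: "conv A a" "conv B b" for A B a b
    unfolding conv_def
  proof (intro allI impI)
    fix e :: real
    assume "0 < e"
    \<comment> \<open>from \<open>A B - a b = A (B - b) + b (A - a)\<close>; the summand \<open>1\<close> keeps the denominator positive\<close>
    define d where "d = e / (norm A + cmod b + 1)"
    have pos: "0 < norm A + cmod b + 1"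
      by (simp add: add_nonneg_pos)
    with \<open>0 < e\<close> have d: "0 < d"
      by (simp add: d_def)
    have "d * (norm A + cmod b + 1) = e"
      using pos by (simp add: d_def)
    then have "norm A * d + cmod b * d = e - d"
      by (simp add: algebra_simps)
    with d have de: "norm A * d + cmod b * d \<le> e"
      by simp
    obtain Q R where "Q \<in> F" "\<And>x. Q x = x \<Longrightarrow> norm (A x - a *\<^sub>C x) \<le> d * norm x"
      "R \<in> F" "\<And>x. R x = x \<Longrightarrow> norm (B x - b *\<^sub>C x) \<le> d * norm x"
      using conv_AB d unfolding conv_def by meson
    moreover from this obtain S where S: "S \<in> F" "\<forall>x. S x = x \<longrightarrow> Q x = x \<and> R x = x"
      using F_common by meson
    ultimately have S': "norm (A x - a *\<^sub>C x) \<le> d * norm x" "norm (B x - b *\<^sub>C x) \<le> d * norm x"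
      if "S x = x" for x
      using that by blast+
    have "norm ((A o\<^sub>L B) x - (a * b) *\<^sub>C x) \<le> e * norm x" if "S x = x" for x
    proof -
      have "(A o\<^sub>L B) x - (a * b) *\<^sub>C x = A (B x - b *\<^sub>C x) + b *\<^sub>C (A x - a *\<^sub>C x)"
        by (simp add: blinfun.diff_right bounded_ops_scaleC[OF \<open>A \<in> bounded_ops\<close>]
            scaleC_diff_right scaleC_scaleC mult.commute)
      then have "norm ((A o\<^sub>L B) x - (a * b) *\<^sub>C x)
          \<le> norm (A (B x - b *\<^sub>C x)) + cmod b * norm (A x - a *\<^sub>C x)"
        using norm_triangle_ineq[of "A (B x - b *\<^sub>C x)" "b *\<^sub>C (A x - a *\<^sub>C x)"]
        by (simp only: norm_scaleC)
      also have "\<dots> \<le> norm A * (d * norm x) + cmod b * (d * norm x)"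
      proof (intro add_mono mult_left_mono S'[OF that])
        show "norm (A (B x - b *\<^sub>C x)) \<le> norm A * (d * norm x)"
          using norm_blinfun[of A "B x - b *\<^sub>C x"] mult_left_mono[OF S'(2)[OF that] norm_ge_zero[of A]]
          by (rule order_trans)
      qed simp
      also have "\<dots> = (norm A * d + cmod b * d) * norm x"
        by (simp add: distrib_right mult.assoc)
      also have "\<dots> \<le> e * norm x"
        by (intro mult_right_mono de) simp
      finally show ?thesis .
    qed
    with S(1) show "\<exists>Q\<in>F. \<forall>x. Q x = x \<longrightarrow> norm ((A o\<^sub>L B) x - (a * b) *\<^sub>C x) \<le> e * norm x"
      by blast
  qed
  have conv_eq: "conv A a" if "Q \<in> F" "\<And>x. Q x = x \<Longrightarrow> A x = a *\<^sub>C x" for A :: "'a op" and a Q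
    unfolding conv_def using that by (auto intro!: bexI[of _ Q])
  have conv_scale: "conv (scale_op c A) (c * a)" if "conv A a" for A a c
  proof -
    have "scale_op c A = scale_op c id_blinfun o\<^sub>L A"
      by (rule blinfun_eqI) (simp add: op_apply)
    moreover have "conv (scale_op c id_blinfun) c"
      by (rule conv_eq[OF FP(3)]) (simp add: op_apply)
    ultimately show ?thesis
      using conv_compose that scale_in_bounded_ops[OF id_in_bounded_ops] by metis
  qed
  have conv_selfadjoint: "\<exists>a. conv A a" if A: "A \<in> V" "selfadjoint A" for A
  proof -
    define L where "L = {c. \<exists>Q\<in>F. \<forall>x. Q x = x \<longrightarrow> c * (norm x)\<^sup>2 \<le> Re (cinner x (A x))}"
    have form: "\<bar>Re (cinner x (A x))\<bar> \<le> norm A * (norm x)\<^sup>2" for x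
    proof -
      have "\<bar>Re (cinner x (A x))\<bar> \<le> norm x * norm (A x)"
        using cinner_Cauchy_Schwarz[of x "A x"] abs_Re_le_cmod[of "cinner x (A x)"] by linarith
      also have "\<dots> \<le> norm x * (norm A * norm x)"
        by (intro mult_left_mono norm_blinfun) simp
      finally show ?thesis
        by (simp add: power2_eq_square ac_simps)
    qed
    have "- norm A * (norm x)\<^sup>2 \<le> Re (cinner x (A x))" for x
      using form[of x] by linarith
    then have "- norm A \<in> L"
      unfolding L_def using FP(3) by blast
    then have "L \<noteq> {}"
      by blast
    have "c \<le> norm A" if "c \<in> L" for c
    proof -
      from that obtain Q where Q: "Q \<in> F" "\<forall>x. Q x = x \<longrightarrow> c * (norm x)\<^sup>2 \<le> Re (cinner x (A x))"
        unfolding L_def by blast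
      obtain x where x: "x \<noteq> 0" "Q x = x"
        using F_nonzero[OF Q(1)] by blast
      have "c * (norm x)\<^sup>2 \<le> norm A * (norm x)\<^sup>2"
        using Q(2) x(2) form[of x] by force
      then show ?thesis
        using x(1) by simp
    qed
    then have "bdd_above L"
      by (rule bdd_aboveI)
    define a where "a = Sup L"
    have "\<exists>S\<in>F. \<forall>x. S x = x \<longrightarrow> norm (A x - of_real a *\<^sub>C x) \<le> e * norm x" if e: "0 < e" for e
    proof -
      obtain c where c: "c \<in> L" "a - e < c"
        using less_cSupD[OF \<open>L \<noteq> {}\<close>, of "a - e"] e unfolding a_def by auto
      obtain Q where Q: "Q \<in> F" "\<And>x. Q x = x \<Longrightarrow> c * (norm x)\<^sup>2 \<le> Re (cinner x (A x))"
        using c(1) unfolding L_def by blast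
      define B where "B = A - (a + e) *\<^sub>R id_blinfun"
      have B: "B \<in> V" "selfadjoint B"
        unfolding B_def using A
        by (simp_all add: diff_closed scaleR_closed id_closed selfadjoint_diff selfadjoint_scaleR
            selfadjoint_id)
      have formB: "Re (cinner x (B x)) = Re (cinner x (A x)) - (a + e) * (norm x)\<^sup>2" for x
        unfolding B_def by (simp add: op_apply scaleR_blinfun.rep_eq cinner_linear norm_square)
      obtain R where R: "R \<in> projections V" "\<And>x. R x = x \<Longrightarrow> 0 \<le> Re (cinner x (B x))"
        "\<And>x. R x = 0 \<Longrightarrow> Re (cinner x (B x)) \<le> 0"
        using spectral_cut[OF B] by blast
      have "a + e \<notin> L"
        using cSup_upper[OF _ \<open>bdd_above L\<close>, of "a + e"] e unfolding a_def by auto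
      moreover have "a + e \<in> L" if "R \<in> F"
        unfolding L_def using that R(2) formB by (auto intro!: bexI[of _ R])
      ultimately have "id_blinfun - R \<in> F"
        using ultra[OF R(1)] by blast
      then obtain S where S: "S \<in> F" "\<forall>x. S x = x \<longrightarrow> Q x = x \<and> (id_blinfun - R) x = x"
        using F_common[OF Q(1)] by blast
      define T where "T = A - a *\<^sub>R id_blinfun"
      have T: "T \<in> V" "selfadjoint T"
        unfolding T_def using A
        by (simp_all add: diff_closed scaleR_closed id_closed selfadjoint_diff selfadjoint_scaleR
            selfadjoint_id)
      have formT: "\<bar>Re (cinner x (T x))\<bar> \<le> e * (norm x)\<^sup>2" if "S x = x" for x
      proof -
        have "Q x = x" "R x = 0"
          using S(2) that by (auto simp: op_apply)
        then have "c * (norm x)\<^sup>2 \<le> Re (cinner x (A x))"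
            "Re (cinner x (A x)) \<le> (a + e) * (norm x)\<^sup>2"
          using Q(2)[of x] R(3)[of x] formB[of x] by simp_all
        moreover have "(a - e) * (norm x)\<^sup>2 \<le> c * (norm x)\<^sup>2"
          using c(2) by (intro mult_right_mono) simp_all
        moreover have "Re (cinner x (T x)) = Re (cinner x (A x)) - a * (norm x)\<^sup>2"
          unfolding T_def by (simp add: op_apply scaleR_blinfun.rep_eq cinner_linear norm_square)
        ultimately show ?thesis
          by (simp add: abs_le_iff algebra_simps)
      qed
      have "norm (T x) \<le> e * norm x" if "S x = x" for x
        using quadratic_form_bound_on_projection[OF T F_proj[OF S(1)] _ formT that] e by simp
      then show ?thesis
        using S(1) unfolding T_def by (auto simp: op_apply scaleR_blinfun.rep_eq scaleC_of_real)
    qed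
    then have "conv A (of_real a)"
      unfolding conv_def by blast
    then show ?thesis
      by blast
  qed
  have conv_exists: "\<exists>a. conv A a" if A: "A \<in> V" for A
  proof -
    obtain R S where RS: "R \<in> V" "selfadjoint R" "S \<in> V" "selfadjoint S" "A = R + scale_op \<i> S"
      using cartesian_decomposition[OF A] .
    then show ?thesis
      using conv_selfadjoint conv_add conv_scale by metis
  qed
  define l where "l = restrict (\<lambda>A. THE a. conv A a) V"
  have l_eq: "l A = a" if "A \<in> V" "conv A a" for A a
    unfolding l_def using that conv_unique by (auto intro: the_equality)
  have l_conv: "conv A (l A)" if "A \<in> V" for A
    using conv_exists[OF that] l_eq[OF that] by blast
  have "l \<in> spectrum V"
    unfolding spectrum_def
  proof (intro CollectI conjI ballI allI)
    show "l \<in> extensional V"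
      by (simp add: l_def)
    show "l (A + B) = l A + l B" if "A \<in> V" "B \<in> V" for A B
      using that by (intro l_eq add_closed conv_add l_conv)
    show "l (A o\<^sub>L B) = l A * l B" if "A \<in> V" "B \<in> V" for A B
      using that by (intro l_eq compose_closed conv_compose l_conv bounded)
    show "l (scale_op c A) = c * l A" if "A \<in> V" for A c
      using that by (intro l_eq scale_closed conv_scale l_conv)
    show "l id_blinfun = 1"
      by (intro l_eq id_closed conv_eq[OF FP(3)]) simp
  qed
  moreover have "l P = 1"
    by (intro l_eq projectionsD(1)[OF P(1)] conv_eq[OF FP(2)]) simp
  ultimately show ?thesis
    by (rule that)
qed

text \<open>A character with value \<open>1\<close> at \<open>P (1 - Q)\<close> would belong to \<open>alpha V P\<close> but not to
  \<open>alpha V Q\<close>.\<close>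

lemma alpha_injective: "inj_on (alpha V) (projections V)"
proof -
  have le: "P o\<^sub>L (id_blinfun - Q) = 0"
    if P: "P \<in> projections V" and Q: "Q \<in> projections V" and "alpha V P = alpha V Q" for P Q
  proof (rule ccontr)
    assume "P o\<^sub>L (id_blinfun - Q) \<noteq> 0"
    moreover have PQ: "P o\<^sub>L (id_blinfun - Q) \<in> projections V"
      by (intro compose_projection P complement_projection Q)
    ultimately obtain l where l: "l \<in> spectrum V" "l (P o\<^sub>L (id_blinfun - Q)) = 1"
      using character_at_projection_exists by blast
    then have "l \<in> alpha V (P o\<^sub>L (id_blinfun - Q))"
      unfolding alpha_def by blast
    then show False
      using that by (simp add: alpha_compose[OF P complement_projection[OF Q]] alpha_complement[OF Q])
  qed
  show ?thesis
  proof (rule inj_onI)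
    fix P Q
    assume P: "P \<in> projections V" and Q: "Q \<in> projections V" and eq: "alpha V P = alpha V Q"
    have "P = P o\<^sub>L Q" "Q = Q o\<^sub>L P"
      using le[OF P Q eq] le[OF Q P eq[symmetric]] by (simp_all add: compose_distrib)
    then show "P = Q"
      using commute[OF projectionsD(1)[OF P] projectionsD(1)[OF Q]] by simp
  qed
qed

end

section \<open>Conjugation by a unitary\<close>

text \<open>These closure properties suffice to transport characters, and for a conjugated algebra
  they are easier to verify than the double commutant property.\<close>

definition unital_subalgebra :: "'a::complex_hilbert op set \<Rightarrow> bool" where
  "unital_subalgebra V \<longleftrightarrow> V \<subseteq> bounded_ops \<and> id_blinfun \<in> V \<and>
     (\<forall>A\<in>V. \<forall>B\<in>V. A + B \<in> V \<and> A o\<^sub>L B \<in> V) \<and> (\<forall>A\<in>V. \<forall>c. scale_op c A \<in> V)"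

lemma (in abelian_von_neumann_algebra) unital_subalgebra: "unital_subalgebra V"
  unfolding unital_subalgebra_def
  by (auto simp: bounded id_closed add_closed compose_closed scale_closed)

lemma unitary_adj: "unitary U \<Longrightarrow> unitary (adj U)"
  unfolding unitary_def by (simp add: adj_adj adj_in_bounded_ops)

lemma unitary_adj_cancel:
  assumes "unitary U"
  shows "adj U (U x) = x" "U (adj U x) = x"
  using assms unfolding unitary_def by (metis blinfun_apply_blinfun_compose blinfun_apply_id_blinfun)+

lemma phi_adj_phi:
  assumes "unitary U"
  shows "phi (adj U) (phi U A) = A" "phi U (phi (adj U) A) = A"
  using assms unitary_adj_cancel[OF assms] unfolding phi_def unitary_def
  by (auto intro!: blinfun_eqI simp: adj_adj)

lemma phi_add: "phi U (A + B) = phi U A + phi U B"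
  by (simp add: phi_def compose_distrib)

lemma phi_scale: "unitary U \<Longrightarrow> phi U (scale_op c A) = scale_op c (phi U A)"
  unfolding unitary_def phi_def by (intro blinfun_eqI) (simp add: op_apply bounded_ops_scaleC)

lemma phi_compose: "unitary U \<Longrightarrow> phi U (A o\<^sub>L B) = phi U A o\<^sub>L phi U B"
  unfolding phi_def by (intro blinfun_eqI) (simp add: unitary_adj_cancel)

lemma phi_id: "unitary U \<Longrightarrow> phi U id_blinfun = id_blinfun"
  unfolding unitary_def phi_def by simp

lemma phi_bounded_ops: "unitary U \<Longrightarrow> A \<in> bounded_ops \<Longrightarrow> phi U A \<in> bounded_ops"
  unfolding unitary_def phi_def by (simp add: compose_in_bounded_ops adj_in_bounded_ops)

lemma adj_phi: "unitary U \<Longrightarrow> A \<in> bounded_ops \<Longrightarrow> adj (phi U A) = phi U (adj A)"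
  unfolding unitary_def phi_def
  by (simp add: adj_compose compose_in_bounded_ops adj_in_bounded_ops adj_adj blinfun_compose_assoc)

lemma unital_subalgebra_phi_image:
  assumes "unital_subalgebra V" "unitary U"
  shows "unital_subalgebra (phi U ` V)"
proof -
  have "id_blinfun \<in> phi U ` V"
    using assms phi_id[OF assms(2)] unfolding unital_subalgebra_def by (metis imageI)
  then show ?thesis
    using assms(1) unfolding unital_subalgebra_def
    by (auto simp: phi_bounded_ops[OF assms(2)] simp flip: phi_add phi_scale[OF assms(2)] phi_compose[OF assms(2)])
qed

lemma phi_projections:
  assumes "V \<subseteq> bounded_ops" "unitary U" "P \<in> projections V"
  shows "phi U P \<in> projections (phi U ` V)"
proof -
  have P: "P \<in> V" "P o\<^sub>L P = P" "adj P = P" "P \<in> bounded_ops"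
    using assms unfolding projections_def by auto
  then show ?thesis
    using phi_compose[OF assms(2), of P P] adj_phi[OF assms(2) P(4)] unfolding projections_def by simp
qed

lemma spectrum_pullback:
  assumes V: "unital_subalgebra V" and U: "unitary U" and l: "l \<in> spectrum (phi U ` V)"
  shows "compose V l (phi U) \<in> spectrum V"
  using V l unfolding spectrum_def unital_subalgebra_def
  by (auto simp: compose_def phi_add phi_compose[OF U] phi_scale[OF U] phi_id[OF U])

lemma compose_phi_inverse:
  assumes U: "unitary U" and k: "k \<in> extensional V"
  shows "compose V (compose (phi U ` V) k (phi (adj U))) (phi U) = k"
  by (rule extensionalityI[OF compose_extensional k]) (simp add: compose_def phi_adj_phi[OF U])

lemma inj_on_spectrum_pullback:
  assumes U: "unitary U"
  shows "inj_on (\<lambda>l. compose V l (phi U)) (spectrum (phi U ` V))"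
proof (rule inj_onI)
  fix l k
  assume lk: "l \<in> spectrum (phi U ` V)" "k \<in> spectrum (phi U ` V)"
    and eq: "compose V l (phi U) = compose V k (phi U)"
  have "l \<in> extensional (phi U ` V)" "k \<in> extensional (phi U ` V)"
    using lk unfolding spectrum_def by simp_all
  then show "l = k"
  proof (rule extensionalityI)
    fix A
    assume "A \<in> phi U ` V"
    then show "l A = k A"
      using eq by (metis (no_types, lifting) compose_eq imageE)
  qed
qed

text \<open>Pulling characters back along \<open>phi U\<close> is compatible with the identification of projections
  with sets of characters; every character of \<open>V\<close> is a pullback, by way of \<open>phi (adj U)\<close>.\<close>

lemma alpha_phi_image:
  assumes V: "unital_subalgebra V" and U: "unitary U" and P: "P \<in> V"
  shows "alpha V P = (\<lambda>l. compose V l (phi U)) ` alpha (phi U ` V) (phi U P)"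
proof (intro equalityI subsetI)
  fix k
  assume "k \<in> alpha V P"
  then have k: "k \<in> spectrum V" "k P = 1"
    unfolding alpha_def by simp_all
  define l where "l = compose (phi U ` V) k (phi (adj U))"
  have adjU: "phi (adj U) ` phi U ` V = V"
    by (simp add: image_image phi_adj_phi[OF U])
  have "l \<in> spectrum (phi U ` V)"
    unfolding l_def using k(1)
    by (intro spectrum_pullback unital_subalgebra_phi_image V U unitary_adj) (simp add: adjU)
  moreover have "l (phi U P) = 1"
    using P k(2) by (simp add: l_def compose_def phi_adj_phi[OF U])
  moreover have "k = compose V l (phi U)"
    using k(1) unfolding l_def spectrum_def by (simp add: compose_phi_inverse[OF U])
  ultimately show "k \<in> (\<lambda>l. compose V l (phi U)) ` alpha (phi U ` V) (phi U P)"
    unfolding alpha_def by blast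
next
  fix k
  assume "k \<in> (\<lambda>l. compose V l (phi U)) ` alpha (phi U ` V) (phi U P)"
  then show "k \<in> alpha V P"
    unfolding alpha_def using spectrum_pullback[OF V U] P by (auto simp: compose_eq)
qed

lemma unitary_group_adj:
  assumes "unitary_group_in N U"
  shows "adj (U t) = U (- t)"
proof -
  have U: "unitary (U t)" "U (t + - t) = U t o\<^sub>L U (- t)" "U 0 = id_blinfun"
    using assms unfolding unitary_group_in_def by blast+
  have "adj (U t) = adj (U t) o\<^sub>L (U t o\<^sub>L U (- t))"
    using U(2,3) by simp
  also have "\<dots> = (adj (U t) o\<^sub>L U t) o\<^sub>L U (- t)"
    by (rule blinfun_compose_assoc[symmetric])
  also have "\<dots> = U (- t)"
    using U(1) unfolding unitary_def by simp
  finally show ?thesis .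
qed

theorem proposition5p1:
  fixes N :: "'a::complex_hilbert op set"
    and \<rho>\<^sub>0 :: "'a op \<Rightarrow> complex"
    and S\<^sub>0 :: "'a subobject"
    and U :: "real \<Rightarrow> 'a op"
    and V :: "'a op set"
    and t :: real
  assumes "von_neumann_algebra N"
    and "\<not> isomorphic_C2 N"
    and "\<not> has_type_I_summand 2 N"
    and "state_on N \<rho>\<^sub>0"
    and "S\<^sub>0 \<in> clopen_subobjects N"
    and "unitary_group_in N U"
    and "V \<in> contexts N"
  shows "pairing (measure_section (\<rho>\<^sub>0 \<circ> phi (U (- t)))) S\<^sub>0 V
       = pairing (measure_section \<rho>\<^sub>0) (phi_tilde (U t) S\<^sub>0)
           ((\<lambda>A. U (- t) o\<^sub>L A o\<^sub>L U t) ` V)"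
proof -
  interpret abelian_von_neumann_algebra V
    using assms(7) unfolding contexts_def by unfold_locales simp_all
  have unit: "unitary (U t)" "unitary (U (- t))"
    using assms(6) unfolding unitary_group_in_def by blast+
  have adjU: "adj (U t) = U (- t)" "adj (U (- t)) = U t"
    using unitary_group_adj[OF assms(6)] by simp_all
  have Ut: "phi (U t) (phi (U (- t)) A) = A" for A
    using phi_adj_phi(2)[OF unit(1)] by (simp add: adjU)
  define W where "W = phi (U (- t)) ` V"
  have W: "(\<lambda>A. U (- t) o\<^sub>L A o\<^sub>L U t) ` V = W"
    by (simp add: W_def phi_def adjU)
  have VW: "phi (U t) ` W = V"
    by (simp add: W_def image_image Ut)
  have W_alg: "unital_subalgebra W"
    unfolding W_def by (rule unital_subalgebra_phi_image[OF unital_subalgebra unit(2)])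
  then have W_bounded: "W \<subseteq> bounded_ops"
    unfolding unital_subalgebra_def by blast
  let ?c = "\<lambda>l. compose W l (phi (U t))"
  have alpha_W: "alpha W R = ?c ` alpha V (phi (U t) R)" if "R \<in> W" for R
    using alpha_phi_image[OF W_alg unit(1) that] unfolding VW .
  have proj_V: "phi (U t) R \<in> projections V" if "R \<in> projections W" for R
    using phi_projections[OF W_bounded unit(1) that] unfolding VW .
  have c_inj: "inj_on ?c (spectrum V)"
    using inj_on_spectrum_pullback[OF unit(1), of W] unfolding VW .
  have alpha_W_inj: "inj_on (alpha W) (projections W)"
  proof (rule inj_onI)
    fix R R'
    assume R: "R \<in> projections W" "R' \<in> projections W" and "alpha W R = alpha W R'"
    then have "?c ` alpha V (phi (U t) R) = ?c ` alpha V (phi (U t) R')"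
      by (simp add: alpha_W projections_def)
    moreover have "alpha V Q \<subseteq> spectrum V" for Q
      unfolding alpha_def by blast
    ultimately have "alpha V (phi (U t) R) = alpha V (phi (U t) R')"
      by (simp only: inj_on_image_eq_iff[OF c_inj])
    then have "phi (U t) R = phi (U t) R'"
      by (rule inj_onD[OF alpha_injective _ proj_V[OF R(1)] proj_V[OF R(2)]])
    then have "phi (adj (U t)) (phi (U t) R) = phi (adj (U t)) (phi (U t) R')"
      by (rule arg_cong)
    then show "R = R'"
      unfolding phi_adj_phi(1)[OF unit(1)] .
  qed
  have "S\<^sub>0 V \<in> clopens V"
    using assms(5,7) unfolding clopen_subobjects_def by blast
  then obtain P where P: "P \<in> projections V" "alpha V P = S\<^sub>0 V"
    using alpha_surjective by blast
  define R where "R = phi (U (- t)) P"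
  have R: "R \<in> projections W"
    unfolding R_def W_def using phi_projections[OF _ unit(2) P(1)] bounded by blast
  have "phi_tilde (U t) S\<^sub>0 W = ?c ` alpha V P"
    by (simp add: phi_tilde_def VW P(2))
  also have "\<dots> = alpha W R"
    using R alpha_W[of R] by (simp add: R_def Ut projections_def)
  finally have "the_inv_into (projections W) (alpha W) (phi_tilde (U t) S\<^sub>0 W) = R"
    using the_inv_into_f_f[OF alpha_W_inj R] by simp
  moreover have "the_inv_into (projections V) (alpha V) (S\<^sub>0 V) = P"
    using the_inv_into_f_f[OF alpha_injective P(1)] P(2) by simp
  ultimately show ?thesis
    unfolding W by (simp add: pairing_def measure_section_def R_def)
qed

end
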